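(* Let $\nu(u,v)$ and $\mu(u,v)$ be smooth functions on a domain $\mathcal D\subset\mathbb R^2$ satisfying $$\mu>0,\quad \nu\neq0,\quad \mu^2\neq\nu^2,\quad |\mu^2-\nu^2|_v\,|\mu^2-\nu^2|_u\neq0,$$ $$\tfrac14\sqrt{|\mu^2-\nu^2|}\,\Delta\ln|\mu^2-\nu^2|+\nu^2+\mu^2=0,\qquad \tfrac12\sqrt{|\mu^2-\nu^2|}\,\Delta\ln\Big|\frac{\mu+\nu}{\mu-\nu}\Big|+2\nu\mu=0,$$ where $\Delta=\partial_u^2+\partial_v^2$. Then there exists a unique up to a rigid motion of $\mathbb R^4$ strongly regular minimal surface of general type $M^2: z=z(u,v)$, $(u,v)\in\mathcal D_0$ for some subdomain $\mathcal D_0\subset\mathcal D$, whose invariants are $\nu(u,v)$ and $\mu(u,v)$; furthermore $(u,v)$ are canonical parameters of $M^2$.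
   Context: $\mathbb R^4$ carries the standard metric $g=\langle\cdot,\cdot\rangle$ and flat connection $\nabla'$; everything is smooth and local. For a regular surface $M^2: z=z(u,v)$ let $E,F,G$ be the first fundamental form coefficients, $\sigma$ the second fundamental form, $K$ the Gauss curvature, and $\varkappa$ the curvature of the normal connection, $\varkappa=g(R^\perp(x,y)n_2,n_1)$ for a positively oriented orthonormal frame $(x,y,n_1,n_2)$ with $x,y$ tangent. Minimal means $\sigma(x,x)+\sigma(y,y)=0$ for orthonormal tangent $x,y$. A minimal surface is of general type if $K^2-\varkappa^2>0$ and $\varkappa\neq0$ everywhere. The ellipse of curvature at $p$ is $\{\sigma(v,v): v\in T_pM^2,\ |v|=1\}$; a tangent line is canonical if it is collinear with an axis of this ellipse. The geometric frame is a positively oriented orthonormal frame $\{x,y,n_1,n_2\}$ with $x,y$ canonical tangent fields and $n_1,n_2$ normal, satisfying $\nabla'_xx=\gamma_1y+\nu n_1$, $\nabla'_xy=-\gamma_1x+\mu n_2$, $\nabla'_yx=-\gamma_2y+\mu n_2$, $\nabla'_yy=\gamma_2x-\nu n_1$, $\nabla'_xn_1=-\nu x+\beta_1n_2$, $\nabla'_yn_1=\nu y+\beta_2n_2$, $\nabla'_xn_2=-\mu y-\beta_1n_1$, $\nabla'_yn_2=-\mu x-\beta_2n_1$, with $\mu>0$, $\nu\ne0$, $\mu^2\ne\nu^2$; the functions $\nu,\mu,\gamma_1,\gamma_2,\beta_1,\beta_2$ are the invariants of $M^2$. Parameters $(u,v)$ are semi-canonical if the parametric lines are integral curves of the canonical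 tangents, with $F=0$, $x=z_u/\sqrt E$, $y=z_v/\sqrt G$; then $\gamma_1=-y(\ln\sqrt E)$, $\gamma_2=-x(\ln\sqrt G)$. A minimal surface of general type is strongly regular if $\gamma_1\gamma_2\neq0$ everywhere. Semi-canonical parameters on a strongly regular minimal surface of general type are canonical if $E\sqrt{|\mu^2-\nu^2|}=G\sqrt{|\mu^2-\nu^2|}=1$. *)

theory Defs
  imports "HOL-Analysis.Analysis"
begin

definition pu :: "(real \<times> real \<Rightarrow> 'a::real_normed_vector) \<Rightarrow> real \<times> real \<Rightarrow> 'a" where
  "pu f p = vector_derivative (\<lambda>s. f (s, snd p)) (at (fst p))"

definition pv :: "(real \<times> real \<Rightarrow> 'a::real_normed_vector) \<Rightarrow> real \<times> real \<Rightarrow> 'a" where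
  "pv f p = vector_derivative (\<lambda>t. f (fst p, t)) (at (snd p))"

fun pder :: "bool list \<Rightarrow> (real \<times> real \<Rightarrow> 'a::real_normed_vector) \<Rightarrow> real \<times> real \<Rightarrow> 'a" where
  "pder [] f = f"
| "pder (b # bs) f = (if b then pu (pder bs f) else pv (pder bs f))"

definition has_partials_on :: "(real \<times> real) set \<Rightarrow> (real \<times> real \<Rightarrow> 'a::real_normed_vector) \<Rightarrow> bool" where
  "has_partials_on D f \<longleftrightarrow> (\<forall>p\<in>D. (\<lambda>s. f (s, snd p)) differentiable (at (fst p))
                                  \<and> (\<lambda>t. f (fst p, t)) differentiable (at (snd p)))"

definition smooth_on :: "(real \<times> real) set \<Rightarrow> (real \<times> real \<Rightarrow> 'a::real_normed_vector) \<Rightarrow> bool" where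
  "smooth_on D f \<longleftrightarrow> (\<forall>ds. has_partials_on D (pder ds f) \<and> continuous_on D (pder ds f))"

definition laplacian :: "(real \<times> real \<Rightarrow> real) \<Rightarrow> real \<times> real \<Rightarrow> real" where
  "laplacian f p = pu (pu f) p + pv (pv f) p"

definition is_domain :: "(real \<times> real) set \<Rightarrow> bool" where
  "is_domain D \<longleftrightarrow> open D \<and> connected D \<and> D \<noteq> {}"

type_synonym surf = "real \<times> real \<Rightarrow> real^4"

definition fE :: "surf \<Rightarrow> real \<times> real \<Rightarrow> real" where "fE z p = pu z p \<bullet> pu z p"
definition fF :: "surf \<Rightarrow> real \<times> real \<Rightarrow> real" where "fF z p = pu z p \<bullet> pv z p"
definition fG :: "surf \<Rightarrow> real \<times> real \<Rightarrow> real" where "fG z p = pv z p \<bullet> pv z p"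

definition regular_on :: "(real \<times> real) set \<Rightarrow> surf \<Rightarrow> bool" where
  "regular_on D z \<longleftrightarrow> (\<forall>p\<in>D. \<forall>a b. a *\<^sub>R pu z p + b *\<^sub>R pv z p = 0 \<longrightarrow> a = 0 \<and> b = 0)"

definition normal_frame_at :: "surf \<Rightarrow> real^4 \<Rightarrow> real^4 \<Rightarrow> real \<times> real \<Rightarrow> bool" where
  "normal_frame_at z n1 n2 p \<longleftrightarrow> n1 \<bullet> n1 = 1 \<and> n2 \<bullet> n2 = 1 \<and> n1 \<bullet> n2 = 0
     \<and> n1 \<bullet> pu z p = 0 \<and> n1 \<bullet> pv z p = 0 \<and> n2 \<bullet> pu z p = 0 \<and> n2 \<bullet> pv z p = 0"

definition nproj :: "real^4 \<Rightarrow> real^4 \<Rightarrow> real^4 \<Rightarrow> real^4" where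
  "nproj n1 n2 w = (w \<bullet> n1) *\<^sub>R n1 + (w \<bullet> n2) *\<^sub>R n2"

definition sff :: "surf \<Rightarrow> real^4 \<Rightarrow> real^4 \<Rightarrow> real \<times> real \<Rightarrow> real \<Rightarrow> real \<Rightarrow> real^4" where
  "sff z n1 n2 p a b = nproj n1 n2 ((a^2) *\<^sub>R pu (pu z) p + (2*a*b) *\<^sub>R pv (pu z) p + (b^2) *\<^sub>R pv (pv z) p)"

definition sff2 :: "surf \<Rightarrow> real^4 \<Rightarrow> real^4 \<Rightarrow> real \<times> real \<Rightarrow> real \<Rightarrow> real \<Rightarrow> real \<Rightarrow> real \<Rightarrow> real^4" where
  "sff2 z n1 n2 p a b c d = nproj n1 n2 ((a*c) *\<^sub>R pu (pu z) p + (a*d + b*c) *\<^sub>R pv (pu z) p + (b*d) *\<^sub>R pv (pv z) p)"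

definition tvec :: "surf \<Rightarrow> real \<times> real \<Rightarrow> real \<Rightarrow> real \<Rightarrow> real^4" where
  "tvec z p a b = a *\<^sub>R pu z p + b *\<^sub>R pv z p"

definition unit_tan :: "surf \<Rightarrow> real \<times> real \<Rightarrow> real \<Rightarrow> real \<Rightarrow> bool" where
  "unit_tan z p a b \<longleftrightarrow> norm (tvec z p a b) = 1"

definition curv_ellipse :: "surf \<Rightarrow> real^4 \<Rightarrow> real^4 \<Rightarrow> real \<times> real \<Rightarrow> (real^4) set" where
  "curv_ellipse z n1 n2 p = {sff z n1 n2 p a b | a b. unit_tan z p a b}"

definition mean_curv :: "surf \<Rightarrow> real^4 \<Rightarrow> real^4 \<Rightarrow> real \<times> real \<Rightarrow> real^4" where
  "mean_curv z n1 n2 p =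
     (1 / (2 * (fE z p * fG z p - (fF z p)^2))) *\<^sub>R
       nproj n1 n2 (fG z p *\<^sub>R pu (pu z) p - (2 * fF z p) *\<^sub>R pv (pu z) p + fE z p *\<^sub>R pv (pv z) p)"

text \<open>The tangent line spanned by the unit vector a z_u + b z_v is canonical iff it is collinear
  with an axis of the ellipse of curvature, i.e. sigma(X,X) is a vertex of the ellipse: a point of
  the ellipse at maximal or minimal distance from its centre.\<close>

definition canonical_dir :: "surf \<Rightarrow> real^4 \<Rightarrow> real^4 \<Rightarrow> real \<times> real \<Rightarrow> real \<Rightarrow> real \<Rightarrow> bool" where
  "canonical_dir z n1 n2 p a b \<longleftrightarrow> unit_tan z p a b \<and>
     ((\<forall>q\<in>curv_ellipse z n1 n2 p. dist q (mean_curv z n1 n2 p) \<le> dist (sff z n1 n2 p a b) (mean_curv z n1 n2 p))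
    \<or> (\<forall>q\<in>curv_ellipse z n1 n2 p. dist (sff z n1 n2 p a b) (mean_curv z n1 n2 p) \<le> dist q (mean_curv z n1 n2 p)))"

definition minimal_at :: "surf \<Rightarrow> real^4 \<Rightarrow> real^4 \<Rightarrow> real \<times> real \<Rightarrow> bool" where
  "minimal_at z n1 n2 p \<longleftrightarrow> (\<forall>a b c d. unit_tan z p a b \<and> unit_tan z p c d
       \<and> tvec z p a b \<bullet> tvec z p c d = 0 \<longrightarrow> sff z n1 n2 p a b + sff z n1 n2 p c d = 0)"

text \<open>Gauss curvature (Gauss equation) and curvature of the normal connection
  kappa = g(R^perp(x,y) n2, n1) for a positively oriented orthonormal frame (x,y,n1,n2) with
  (x,y) oriented like (z_u,z_v); by tensoriality R^perp(x,y) = R^perp(d_u,d_v)/sqrt(EG-F^2)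
  and nabla^perp_v n2 = <n2_v,n1> n1.\<close>

definition gauss_curv :: "surf \<Rightarrow> real^4 \<Rightarrow> real^4 \<Rightarrow> real \<times> real \<Rightarrow> real" where
  "gauss_curv z n1 n2 p =
     (sff2 z n1 n2 p 1 0 1 0 \<bullet> sff2 z n1 n2 p 0 1 0 1 - sff2 z n1 n2 p 1 0 0 1 \<bullet> sff2 z n1 n2 p 1 0 0 1)
     / (fE z p * fG z p - (fF z p)^2)"

definition normal_curv :: "surf \<Rightarrow> surf \<Rightarrow> surf \<Rightarrow> real \<times> real \<Rightarrow> real" where
  "normal_curv z n1 n2 p =
     (pu (\<lambda>q. pv n2 q \<bullet> n1 q) p - pv (\<lambda>q. pu n2 q \<bullet> n1 q) p)
     / sqrt (fE z p * fG z p - (fF z p)^2)"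

definition pos_oriented :: "real^4 \<Rightarrow> real^4 \<Rightarrow> real^4 \<Rightarrow> real^4 \<Rightarrow> bool" where
  "pos_oriented a b c d \<longleftrightarrow> det (vector [a, b, c, d] :: real^4^4) > 0"

definition xfield :: "surf \<Rightarrow> surf" where "xfield z p = (1 / sqrt (fE z p)) *\<^sub>R pu z p"
definition yfield :: "surf \<Rightarrow> surf" where "yfield z p = (1 / sqrt (fG z p)) *\<^sub>R pv z p"

definition Dx :: "surf \<Rightarrow> surf \<Rightarrow> real \<times> real \<Rightarrow> real^4" where
  "Dx z W p = (1 / sqrt (fE z p)) *\<^sub>R pu W p"
definition Dy :: "surf \<Rightarrow> surf \<Rightarrow> real \<times> real \<Rightarrow> real^4" where
  "Dy z W p = (1 / sqrt (fG z p)) *\<^sub>R pv W p"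

definition geometric_frame_on ::
  "(real \<times> real) set \<Rightarrow> surf \<Rightarrow> surf \<Rightarrow> surf \<Rightarrow>
   (real \<times> real \<Rightarrow> real) \<Rightarrow> (real \<times> real \<Rightarrow> real) \<Rightarrow>
   (real \<times> real \<Rightarrow> real) \<Rightarrow> (real \<times> real \<Rightarrow> real) \<Rightarrow>
   (real \<times> real \<Rightarrow> real) \<Rightarrow> (real \<times> real \<Rightarrow> real) \<Rightarrow> bool" where
  "geometric_frame_on D z n1 n2 nu mu g1 g2 b1 b2 \<longleftrightarrow>
    (\<forall>p\<in>D. let x = xfield z; y = yfield z in
        x p \<bullet> x p = 1 \<and> y p \<bullet> y p = 1 \<and> x p \<bullet> y p = 0
      \<and> normal_frame_at z (n1 p) (n2 p) p
      \<and> pos_oriented (x p) (y p) (n1 p) (n2 p)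
      \<and> canonical_dir z (n1 p) (n2 p) p (1 / sqrt (fE z p)) 0
      \<and> canonical_dir z (n1 p) (n2 p) p 0 (1 / sqrt (fG z p))
      \<and> Dx z x p = g1 p *\<^sub>R y p + nu p *\<^sub>R n1 p
      \<and> Dx z y p = - g1 p *\<^sub>R x p + mu p *\<^sub>R n2 p
      \<and> Dy z x p = - g2 p *\<^sub>R y p + mu p *\<^sub>R n2 p
      \<and> Dy z y p = g2 p *\<^sub>R x p - nu p *\<^sub>R n1 p
      \<and> Dx z n1 p = - nu p *\<^sub>R x p + b1 p *\<^sub>R n2 p
      \<and> Dy z n1 p = nu p *\<^sub>R y p + b2 p *\<^sub>R n2 p
      \<and> Dx z n2 p = - mu p *\<^sub>R y p - b1 p *\<^sub>R n1 p
      \<and> Dy z n2 p = - mu p *\<^sub>R x p - b2 p *\<^sub>R n1 p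
      \<and> mu p > 0 \<and> nu p \<noteq> 0 \<and> (mu p)^2 \<noteq> (nu p)^2)"

definition canonical_surface_with_invariants ::
  "(real \<times> real) set \<Rightarrow> surf \<Rightarrow> (real \<times> real \<Rightarrow> real) \<Rightarrow> (real \<times> real \<Rightarrow> real) \<Rightarrow> bool" where
  "canonical_surface_with_invariants D0 z nu mu \<longleftrightarrow>
     smooth_on D0 z \<and> regular_on D0 z \<and>
     (\<exists>n1 n2 g1 g2 b1 b2. smooth_on D0 n1 \<and> smooth_on D0 n2 \<and>
        geometric_frame_on D0 z n1 n2 nu mu g1 g2 b1 b2 \<and>
        (\<forall>p\<in>D0.
            minimal_at z (n1 p) (n2 p) p
          \<and> (gauss_curv z (n1 p) (n2 p) p)^2 - (normal_curv z n1 n2 p)^2 > 0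
          \<and> normal_curv z n1 n2 p \<noteq> 0
          \<and> g1 p * g2 p \<noteq> 0
          \<and> fF z p = 0
          \<and> fE z p * sqrt \<bar>(mu p)^2 - (nu p)^2\<bar> = 1
          \<and> fG z p * sqrt \<bar>(mu p)^2 - (nu p)^2\<bar> = 1))"

definition proper_motion_related :: "(real \<times> real) set \<Rightarrow> surf \<Rightarrow> surf \<Rightarrow> bool" where
  "proper_motion_related D z1 z2 \<longleftrightarrow>
     (\<exists>A :: real^4^4. \<exists>c :: real^4. orthogonal_matrix A \<and> det A = 1 \<and>
        (\<forall>p\<in>D. z2 p = A *v z1 p + c))"

end

theory Submission
  imports Defs
begin

text \<open>Put \<open>\<phi> = ln \<bar>\<mu>\<^sup>2 - \<nu>\<^sup>2\<bar>\<close>, \<open>\<theta> = 1/2 ln \<bar>(\<mu> + \<nu>) / (\<mu> - \<nu>)\<bar>\<close> and \<open>\<lambda> = exp (- \<phi> / 4)\<close>. In canonical parameters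
  \<open>E = G = \<lambda>\<^sup>2\<close>, and equality of the mixed partial derivatives of \<open>z\<close>, \<open>x\<close>, \<open>y\<close> forces
  \<open>\<lambda> \<gamma>\<^sub>1 = \<phi>\<^sub>v / 4\<close>, \<open>\<lambda> \<gamma>\<^sub>2 = \<phi>\<^sub>u / 4\<close>, \<open>\<lambda> \<beta>\<^sub>1 = - \<theta>\<^sub>v\<close>, \<open>\<lambda> \<beta>\<^sub>2 = \<theta>\<^sub>u\<close>. So the frame satisfies a linear system
  \<open>W\<^sub>u = A W\<close>, \<open>W\<^sub>v = B W\<close> with skew \<open>A\<close>, \<open>B\<close> determined by \<open>\<mu>\<close> and \<open>\<nu>\<close>. If \<open>V\<close>, \<open>W\<close> are two frames, then
  \<open>V\<^sup>T W\<close> is constant, which gives uniqueness. For existence, the Codazzi equations hold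
  identically and the two given equations are the Gauss and Ricci equations, so the system is flat
  and can be solved on a small square; the solution stays orthogonal because \<open>W\<^sup>T W\<close> is constant.\<close>

section \<open>Partial derivatives and smoothness\<close>

text \<open>The choice of \<open>phi\<close> and \<open>theta\<close> comes from splitting a
  logarithm: ln |mu + nu| = phi/2 + theta and ln |mu - nu| = phi/2 - theta. Differentiation gives d
  nu = nu d phi / 2 + mu d theta and d mu = mu d phi / 2 + nu d theta, which are the Codazzi
  equations. A flat system is overdetermined. Integrating along one horizontal and one vertical
  segment from a corner turns it into a single fixed point equation. Its solution satisfies the
  vertical equation by construction, and flatness yields the horizontal one. As the integration runs
  forward only, the initial point is a corner of the closed square and lies outside the open square
  carrying the surface; orthogonality and orientation are therefore transported from the boundary by
  continuity. For uniqueness, the gammas and betas of a given surface are just some functions under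
  an existential quantifier and must be identified before two frames can be compared. General type
  comes from K = -(nu^2 + mu^2) and normal curvature 2 nu mu, since then K^2 - kappa^2 = (mu^2 -
  nu^2)^2.\<close>

definition coord :: "bool \<Rightarrow> real \<times> real \<Rightarrow> real" where
  "coord b p = (if b then fst p else snd p)"

definition move :: "bool \<Rightarrow> real \<times> real \<Rightarrow> real \<Rightarrow> real \<times> real" where
  "move b p r = (if b then (r, snd p) else (fst p, r))"

text \<open>A Boolean selects the coordinate (\<open>True\<close> for u, as in \<open>pder\<close>),
  so each rule is proved once for both directions. The relation asserts differentiability, which the
  total operator \<open>pd\<close> does not.\<close>

definition has_pd :: "bool \<Rightarrow> (real \<times> real \<Rightarrow> 'a::real_normed_vector) \<Rightarrow> 'a \<Rightarrow> real \<times> real \<Rightarrow> bool" where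
  "has_pd b f d p \<longleftrightarrow> ((\<lambda>r. f (move b p r)) has_vector_derivative d) (at (coord b p))"

definition pd :: "bool \<Rightarrow> (real \<times> real \<Rightarrow> 'a::real_normed_vector) \<Rightarrow> real \<times> real \<Rightarrow> 'a" where
  "pd b f = (if b then pu f else pv f)"

lemma move_coord [simp]: "move b p (coord b p) = p"
  by (simp add: move_def coord_def)

lemma continuous_move: "continuous_on UNIV (move b p)"
  unfolding move_def by (cases b) (auto intro!: continuous_intros)

lemma has_pd_imp_pd: "has_pd b f d p \<Longrightarrow> pd b f p = d"
  by (auto simp: has_pd_def pd_def pu_def pv_def move_def coord_def intro: vector_derivative_at)

lemma has_pd_const: "has_pd b (\<lambda>q. c) 0 p"
  by (simp add: has_pd_def)

lemma has_pd_linear: "bounded_linear h \<Longrightarrow> has_pd b f d p \<Longrightarrow> has_pd b (\<lambda>q. h (f q)) (h d) p"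
  unfolding has_pd_def by (rule bounded_linear.has_vector_derivative)

lemma has_pd_bilinear:
  assumes "bounded_bilinear h" "has_pd b f d p" "has_pd b g e p"
  shows "has_pd b (\<lambda>q. h (f q) (g q)) (h (f p) e + h d (g p)) p"
  using bounded_bilinear.has_vector_derivative[OF assms(1) assms(2)[unfolded has_pd_def] assms(3)[unfolded has_pd_def]]
  by (simp add: has_pd_def)

lemma has_pd_add: "has_pd b f d p \<Longrightarrow> has_pd b g e p \<Longrightarrow> has_pd b (\<lambda>q. f q + g q) (d + e) p"
  unfolding has_pd_def by (rule has_vector_derivative_add)

lemma has_pd_sum:
  "(\<And>i. i \<in> I \<Longrightarrow> has_pd b (f i) (d i) p) \<Longrightarrow> has_pd b (\<lambda>q. \<Sum>i\<in>I. f i q) (\<Sum>i\<in>I. d i) p"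
  unfolding has_pd_def by (rule has_vector_derivative_sum)

lemma has_pd_Pair:
  "has_pd b f d p \<Longrightarrow> has_pd b g e p \<Longrightarrow> has_pd b (\<lambda>q. (f q, g q)) (d, e) p"
  unfolding has_pd_def by (rule has_vector_derivative_Pair)

lemma has_pd_cong:
  assumes "open D" "p \<in> D" "\<And>q. q \<in> D \<Longrightarrow> f q = g q" "has_pd b f d p"
  shows "has_pd b g d p"
proof -
  have "open (move b p -` D)"
    using assms(1) continuous_move by (rule open_vimage)
  then show ?thesis
    using assms unfolding has_pd_def
    by (elim has_vector_derivative_transform_within_open[where S = "move b p -` D"]) auto
qed

lemma has_pd_chain:
  assumes "has_pd b f d p" "(h has_real_derivative h') (at (f p))"
  shows "has_pd b (\<lambda>q. h (f q)) (h' * d) p"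
  using field_vector_diff_chain_at[of "\<lambda>r. f (move b p r)" d "coord b p" h h'] assms
  by (simp add: has_pd_def o_def has_real_derivative_iff_has_vector_derivative[symmetric] mult.commute
      has_vector_derivative_def has_field_derivative_def)

text \<open>A vector is a finite sum of linear images of its components, so componentwise claims
  reduce to the rules for sums and linear maps.\<close>

lemma vec_eq_sum_axis:
  fixes x :: "'a::real_normed_vector ^ 'n"
  shows "x = (\<Sum>i\<in>UNIV. axis i (x $ i))"
  by (simp add: vec_eq_iff axis_def)

lemma bounded_linear_axis: "bounded_linear (axis i :: 'a::euclidean_space \<Rightarrow> 'a ^ 'n)"
  unfolding linear_conv_bounded_linear[symmetric]
  by (intro linearI) (auto simp: vec_eq_iff axis_def)

lemma has_pd_vec:
  fixes f :: "real \<times> real \<Rightarrow> 'a::euclidean_space ^ 'n"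
  assumes "\<And>i. has_pd b (\<lambda>q. f q $ i) (d $ i) p"
  shows "has_pd b f d p"
proof -
  have "has_pd b (\<lambda>q. axis i (f q $ i)) (axis i (d $ i)) p" for i
    by (rule has_pd_linear[OF bounded_linear_axis assms])
  then have "has_pd b (\<lambda>q. \<Sum>i\<in>UNIV. axis i (f q $ i)) (\<Sum>i\<in>UNIV. axis i (d $ i)) p"
    by (intro has_pd_sum) auto
  then show ?thesis
    by (simp only: vec_eq_sum_axis[symmetric])
qed

text \<open>Quantifying over a representative of the partial derivative, instead of taking
  \<open>pd b f\<close>, makes this notion depend only on the values of the function on \<open>D\<close>.\<close>

primrec Ck :: "nat \<Rightarrow> (real \<times> real) set \<Rightarrow> (real \<times> real \<Rightarrow> 'a::real_normed_vector) \<Rightarrow> bool" where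
  "Ck 0 D f \<longleftrightarrow> continuous_on D f"
| "Ck (Suc k) D f \<longleftrightarrow> continuous_on D f \<and> (\<forall>b. \<exists>g. (\<forall>p\<in>D. has_pd b f (g p) p) \<and> Ck k D g)"

lemma Ck_continuous: "Ck k D f \<Longrightarrow> continuous_on D f"
  by (cases k) auto

lemma Ck_Suc_imp: "Ck (Suc k) D f \<Longrightarrow> Ck k D f"
proof (induction k arbitrary: f)
  case (Suc k)
  then show ?case
    using Ck.simps(2)[of k D f] Ck.simps(2)[of "Suc k" D f] by metis
qed simp

lemma Ck_cong:
  assumes D: "open D" and eq: "\<And>q. q \<in> D \<Longrightarrow> f q = g q" and f: "Ck k D f"
  shows "Ck k D g"
proof -
  have "continuous_on D g"
    using Ck_continuous[OF f] eq by (metis continuous_on_cong)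
  then show ?thesis
    using f has_pd_cong[OF D _ eq] by (cases k) (simp, fastforce)
qed

lemma Ck_const: "Ck k D (\<lambda>q. c)"
proof (induction k arbitrary: c)
  case (Suc k)
  then show ?case
    using has_pd_const by fastforce
qed simp

lemma Ck_linear:
  assumes h: "bounded_linear h"
  shows "Ck k D f \<Longrightarrow> Ck k D (\<lambda>q. h (f q))"
proof (induction k arbitrary: f)
  case 0
  then show ?case
    by (auto intro: bounded_linear.continuous_on[OF h])
next
  case (Suc k)
  have "\<exists>g. (\<forall>p\<in>D. has_pd b (\<lambda>q. h (f q)) (g p) p) \<and> Ck k D g" for b
  proof -
    obtain g where "\<And>p. p \<in> D \<Longrightarrow> has_pd b f (g p) p" "Ck k D g"
      using Suc.prems unfolding Ck.simps by meson
    then show ?thesis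
      using has_pd_linear[OF h] Suc.IH by (intro exI[of _ "\<lambda>q. h (g q)"]) auto
  qed
  then show ?case
    using Suc.prems by (auto intro: bounded_linear.continuous_on[OF h])
qed

lemma Ck_add: "Ck k D f \<Longrightarrow> Ck k D g \<Longrightarrow> Ck k D (\<lambda>q. f q + g q)"
proof (induction k arbitrary: f g)
  case 0
  then show ?case
    by (auto intro!: continuous_intros)
next
  case (Suc k)
  have "\<exists>h. (\<forall>p\<in>D. has_pd b (\<lambda>q. f q + g q) (h p) p) \<and> Ck k D h" for b
  proof -
    obtain f' g' where "\<And>p. p \<in> D \<Longrightarrow> has_pd b f (f' p) p" "Ck k D f'"
        "\<And>p. p \<in> D \<Longrightarrow> has_pd b g (g' p) p" "Ck k D g'"
      using Suc.prems by (simp only: Ck.simps) meson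
    then show ?thesis
      using Suc.IH by (intro exI[of _ "\<lambda>q. f' q + g' q"]) (auto intro: has_pd_add)
  qed
  then show ?case
    using Suc.prems by (auto intro!: continuous_intros)
qed

lemma Ck_bilinear:
  assumes h: "bounded_bilinear h"
  shows "Ck k D f \<Longrightarrow> Ck k D g \<Longrightarrow> Ck k D (\<lambda>q. h (f q) (g q))"
proof (induction k arbitrary: f g)
  case 0
  then show ?case
    by (auto intro: bounded_bilinear.continuous_on[OF h])
next
  case (Suc k)
  have "\<exists>d. (\<forall>p\<in>D. has_pd b (\<lambda>q. h (f q) (g q)) (d p) p) \<and> Ck k D d" for b
  proof -
    obtain f' g' where f': "\<And>p. p \<in> D \<Longrightarrow> has_pd b f (f' p) p" "Ck k D f'"
      and g': "\<And>p. p \<in> D \<Longrightarrow> has_pd b g (g' p) p" "Ck k D g'"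
      using Suc.prems by (simp only: Ck.simps) meson
    have "Ck k D (\<lambda>p. h (f p) (g' p) + h (f' p) (g p))"
      by (rule Ck_add[OF Suc.IH[OF Ck_Suc_imp[OF Suc.prems(1)] g'(2)] Suc.IH[OF f'(2) Ck_Suc_imp[OF Suc.prems(2)]]])
    then show ?thesis
      using has_pd_bilinear[OF h f'(1) g'(1)]
      by (intro exI[of _ "\<lambda>p. h (f p) (g' p) + h (f' p) (g p)"]) simp
  qed
  then show ?case
    using Suc.prems by (auto intro: bounded_bilinear.continuous_on[OF h])
qed

lemma Ck_sum: "(\<And>i. i \<in> I \<Longrightarrow> Ck k D (f i)) \<Longrightarrow> Ck k D (\<lambda>q. \<Sum>i\<in>I. f i q)"
  by (induction I rule: infinite_finite_induct) (auto intro: Ck_const Ck_add)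

lemma Ck_vec:
  fixes f :: "real \<times> real \<Rightarrow> 'a::euclidean_space ^ 'n"
  assumes "\<And>i. Ck k D (\<lambda>q. f q $ i)"
  shows "Ck k D f"
proof -
  have "Ck k D (\<lambda>q. \<Sum>i\<in>UNIV. axis i (f q $ i))"
    by (intro Ck_sum Ck_linear[OF bounded_linear_axis] assms)
  then show ?thesis
    by (simp only: vec_eq_sum_axis[symmetric])
qed

text \<open>Linear systems bootstrap: a continuous solution gains one derivative in each step.\<close>

lemma Ck_linear_system:
  assumes h: "bounded_bilinear h" and a: "\<And>k b. Ck k D (a b)" and f: "continuous_on D f"
    and pd: "\<And>b p. p \<in> D \<Longrightarrow> has_pd b f (h (a b p) (f p)) p"
  shows "Ck k D f"
proof (induction k)
  case (Suc k)
  have "Ck k D (\<lambda>p. h (a b p) (f p))" for b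
    using a Suc by (rule Ck_bilinear[OF h])
  then have "\<exists>g. (\<forall>p\<in>D. has_pd b f (g p) p) \<and> Ck k D g" for b
    using pd by (intro exI[of _ "\<lambda>p. h (a b p) (f p)"]) blast
  then show ?case
    using f by simp
qed (use f in simp)

text \<open>The derivative -f'/f^2 contains 1/f again, but only to the order that the induction
  hypothesis already supplies.\<close>

lemma Ck_inverse:
  fixes f :: "real \<times> real \<Rightarrow> real"
  assumes nz: "\<And>p. p \<in> D \<Longrightarrow> f p \<noteq> 0"
  shows "Ck k D f \<Longrightarrow> Ck k D (\<lambda>q. inverse (f q))"
proof (induction k)
  case 0
  then show ?case
    using nz by (auto intro!: continuous_intros)
next
  case (Suc k)
  have IH: "Ck k D (\<lambda>q. inverse (f q))"
    using Suc Ck_Suc_imp by blast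
  have "\<exists>d. (\<forall>p\<in>D. has_pd b (\<lambda>q. inverse (f q)) (d p) p) \<and> Ck k D d" for b
  proof -
    obtain g where g: "\<And>p. p \<in> D \<Longrightarrow> has_pd b f (g p) p" "Ck k D g"
      using Suc.prems unfolding Ck.simps by meson
    have "Ck k D (\<lambda>p. - (inverse (f p) * inverse (f p)) * g p)"
      by (intro Ck_bilinear[OF bounded_bilinear_mult] Ck_linear[OF bounded_linear_minus[OF bounded_linear_ident]] IH g(2))
    moreover have "has_pd b (\<lambda>q. inverse (f q)) (- (inverse (f p) * inverse (f p)) * g p) p" if "p \<in> D" for p
    proof -
      have "(inverse has_real_derivative - (inverse (f p) * inverse (f p))) (at (f p))"
        using DERIV_inverse[of "f p"] nz[OF that] by (simp add: power2_eq_square)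
      then show ?thesis
        by (rule has_pd_chain[OF g(1)[OF that]])
    qed
    ultimately show ?thesis
      by (intro exI[of _ "\<lambda>p. - (inverse (f p) * inverse (f p)) * g p"]) simp
  qed
  then show ?case
    using Ck_continuous[OF Suc.prems] nz by (simp add: continuous_on_inverse)
qed

section \<open>Agreement of the two notions of smoothness on open sets\<close>

lemma pder_snoc: "pder (ds @ [b]) f = pder ds (pd b f)"
  by (induction ds) (auto simp: pd_def)

lemma has_partials_on_iff: "has_partials_on D f \<longleftrightarrow> (\<forall>p\<in>D. \<forall>b. has_pd b f (pd b f p) p)"
  by (auto simp: has_partials_on_def has_pd_def pd_def pu_def pv_def move_def coord_def
      vector_derivative_works[symmetric] all_bool_eq)

text \<open>\<open>pder\<close> applies the head of its list last, so the innermost derivative is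
  the one appended at the end.\<close>

lemma smooth_on_pd: "smooth_on D f \<Longrightarrow> smooth_on D (pd b f)"
  by (simp add: smooth_on_def flip: pder_snoc)

lemma smooth_on_has_pd: "smooth_on D f \<Longrightarrow> p \<in> D \<Longrightarrow> has_pd b f (pd b f p) p"
  using has_partials_on_iff unfolding smooth_on_def by (metis pder.simps(1))

lemma smooth_on_imp_Ck: "smooth_on D f \<Longrightarrow> Ck k D f"
proof (induction k arbitrary: f)
  case 0
  then show ?case
    unfolding smooth_on_def by (metis Ck.simps(1) pder.simps(1))
next
  case (Suc k)
  moreover have "continuous_on D f"
    using Suc.prems unfolding smooth_on_def by (metis pder.simps(1))
  ultimately show ?case
    unfolding Ck.simps using smooth_on_pd[OF Suc.prems] smooth_on_has_pd[OF Suc.prems] by blast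
qed

text \<open>Every differentiation costs one order. The representative from \<open>Ck\<close> agrees
  with \<open>pd\<close> on D, and \<open>Ck_cong\<close> allows the exchange.\<close>

lemma Ck_pder:
  assumes D: "open D"
  shows "Ck (length ds + k) D f \<Longrightarrow> Ck k D (pder ds f)"
proof (induction ds arbitrary: k)
  case (Cons b ds)
  have "Ck (Suc k) D (pder ds f)"
    using Cons.prems by (intro Cons.IH) simp
  then obtain g where g: "\<And>p. p \<in> D \<Longrightarrow> has_pd b (pder ds f) (g p) p" "Ck k D g"
    unfolding Ck.simps by meson
  have "Ck k D (pd b (pder ds f))"
    using has_pd_imp_pd[OF g(1)] g(2) by (intro Ck_cong[OF D _ g(2)]) auto
  then show ?case
    by (cases b) (simp_all add: pd_def)
qed simp

lemma smooth_on_iff_Ck: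
  assumes D: "open D"
  shows "smooth_on D f \<longleftrightarrow> (\<forall>k. Ck k D f)"
proof
  assume *: "\<forall>k. Ck k D f"
  show "smooth_on D f"
    unfolding smooth_on_def
  proof
    fix ds
    have "Ck (Suc 0) D (pder ds f)"
      using * by (intro Ck_pder[OF D]) auto
    then show "has_partials_on D (pder ds f) \<and> continuous_on D (pder ds f)"
      unfolding has_partials_on_iff by simp (metis has_pd_imp_pd)
  qed
qed (use smooth_on_imp_Ck in blast)

lemma smooth_on_cong:
  "open D \<Longrightarrow> (\<And>q. q \<in> D \<Longrightarrow> f q = g q) \<Longrightarrow> smooth_on D f \<Longrightarrow> smooth_on D g"
  by (simp add: smooth_on_iff_Ck) (metis Ck_cong)

lemma smooth_on_subset: "smooth_on D f \<Longrightarrow> D' \<subseteq> D \<Longrightarrow> smooth_on D' f"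
  unfolding smooth_on_def has_partials_on_def by (meson continuous_on_subset subsetD)

lemma smooth_on_continuous: "smooth_on D f \<Longrightarrow> continuous_on D f"
  using smooth_on_imp_Ck Ck_continuous by blast

section \<open>Flat linear systems in two variables\<close>

text \<open>The substitution t = a + \<tau> (c x - a) moves the variable limit into the integrand,
  leaving a parameter integral over [0, 1].\<close>

lemma continuous_on_integral_upto:
  fixes F :: "'a::topological_space \<Rightarrow> real \<Rightarrow> 'b::euclidean_space"
  assumes F: "continuous_on (S \<times> UNIV) (\<lambda>(x, t). F x t)" and c: "continuous_on S c"
    and le: "\<And>x. x \<in> S \<Longrightarrow> a \<le> c x"
  shows "continuous_on S (\<lambda>x. integral {a..c x} (F x))"
proof -
  have eq: "integral {a..c x} (F x) = (c x - a) *\<^sub>R integral {0..1} (\<lambda>\<tau>. F x (a + \<tau> * (c x - a)))"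
    if x: "x \<in> S" for x
  proof -
    have "continuous_on UNIV (F x)"
      by (rule continuous_on_compose2[OF F, of UNIV "\<lambda>t. (x, t)", simplified])
        (use x in \<open>auto intro!: continuous_intros\<close>)
    then have cont: "continuous_on {a..c x} (F x)"
      using continuous_on_subset by blast
    have rng: "(\<lambda>\<tau>. a + \<tau> * (c x - a)) ` {0..1} \<subseteq> {a..c x}"
    proof clarsimp
      fix \<tau> :: real assume "0 \<le> \<tau>" "\<tau> \<le> 1"
      then have "0 \<le> \<tau> * (c x - a)" "\<tau> * (c x - a) \<le> 1 * (c x - a)"
        using le[OF x] by (simp, intro mult_right_mono) auto
      then show "0 \<le> \<tau> * (c x - a) \<and> a + \<tau> * (c x - a) \<le> c x"
        by simp
    qed
    have "((\<lambda>\<tau>. (c x - a) *\<^sub>R F x (a + \<tau> * (c x - a))) has_integral integral {a..c x} (F x)) {0..1}"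
    proof -
      have "((\<lambda>\<tau>. a + \<tau> * (c x - a)) has_real_derivative c x - a) (at \<tau> within {0..1})" for \<tau>
        by (auto intro!: derivative_eq_intros)
      then show ?thesis
        using has_integral_substitution[of 0 1 "\<lambda>\<tau>. a + \<tau> * (c x - a)" a "c x" "F x" "\<lambda>_. c x - a"] cont le[OF x] rng
        by simp
    qed
    then show ?thesis
      by (simp flip: integral_cmul add: integral_unique)
  qed
  have "continuous_on S (\<lambda>x. integral (cbox 0 1) (\<lambda>\<tau>. F x (a + \<tau> * (c x - a))))"
  proof (rule integral_continuous_on_param)
    have "continuous_on (S \<times> cbox 0 1) (\<lambda>p. case (fst p, a + snd p * (c (fst p) - a)) of (x, t) \<Rightarrow> F x t)"
      by (rule continuous_on_compose2[OF F]) (auto intro!: continuous_intros continuous_on_compose2[OF c])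
    then show "continuous_on (S \<times> cbox 0 1) (\<lambda>(x, \<tau>). F x (a + \<tau> * (c x - a)))"
      by (simp add: case_prod_beta)
  qed
  then have "continuous_on S (\<lambda>x. (c x - a) *\<^sub>R integral {0..1} (\<lambda>\<tau>. F x (a + \<tau> * (c x - a))))"
    using c by (auto intro!: continuous_intros)
  then show ?thesis
    using eq by (simp cong: continuous_on_cong)
qed

context
  fixes h :: "'a::real_normed_vector \<Rightarrow> 'b::euclidean_space \<Rightarrow> 'b"
  assumes h: "bounded_bilinear h"
begin

text \<open>Picard iteration along the path (u0, v0), (u, v0), (u, v), by Banach's theorem in the
  bounded continuous functions on the plane.\<close>

lemma goursat_integral_equation:
  fixes A B :: "real \<times> real \<Rightarrow> 'a" and w0 :: 'b
  assumes A: "continuous_on UNIV A" and B: "continuous_on UNIV B"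
    and bA: "\<And>p w. norm (h (A p) w) \<le> K * norm w" and bB: "\<And>p w. norm (h (B p) w) \<le> K * norm w"
    and d: "0 < d" "4 * (d * K) \<le> 1"
  obtains W where "continuous_on UNIV W"
    "\<And>u v. u \<in> {u0..u0+d} \<Longrightarrow> v \<in> {v0..v0+d} \<Longrightarrow> W (u, v) = w0 +
       integral {u0..u} (\<lambda>s. h (A (s, v0)) (W (s, v0))) + integral {v0..v} (\<lambda>t. h (B (u, t)) (W (u, t)))"
proof -
  \<comment> \<open>Clamping the end point to the square makes the operator act on functions on the
    whole plane while both paths of integration have length at most d.\<close>
  define cu where "cu p = max u0 (min (fst p) (u0+d))" for p :: "real \<times> real"
  define cv where "cv p = max v0 (min (snd p) (v0+d))" for p :: "real \<times> real"
  define T where "T W p = w0 + integral {u0..cu p} (\<lambda>s. h (A (s, v0)) (W (s, v0)))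
       + integral {v0..cv p} (\<lambda>t. h (B (cu p, t)) (W (cu p, t)))" for W p
  have cu: "u0 \<le> cu p" "cu p \<le> u0 + d" and cv: "v0 \<le> cv p" "cv p \<le> v0 + d" for p
    using d by (auto simp: cu_def cv_def)
  have ccu: "continuous_on UNIV cu" and ccv: "continuous_on UNIV cv"
    unfolding cu_def cv_def by (auto intro!: continuous_intros)
  note hc = bounded_bilinear.continuous_on[OF h]
  have K: "0 \<le> K"
  proof -
    obtain b :: 'b where "b \<in> Basis"
      by fastforce
    then show ?thesis
      using order_trans[OF norm_ge_zero bA[of _ b]] by simp
  qed
  have contT: "continuous_on UNIV (T W)" if W: "continuous_on UNIV W" for W
    unfolding T_def
    by (intro continuous_intros continuous_on_integral_upto ccu ccv cu cv)
      (auto simp: case_prod_beta intro!: hc continuous_on_compose2[OF A] continuous_on_compose2[OF B]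
        continuous_on_compose2[OF W] continuous_on_compose2[OF ccu] continuous_intros)
  have sl: "continuous_on S (\<lambda>s. h (A (s, v)) (W (s, v)))" "continuous_on S (\<lambda>t. h (B (u, t)) (W (u, t)))"
    if W: "continuous_on UNIV W" for W S u v
    by (auto intro!: hc continuous_on_compose2[OF A] continuous_on_compose2[OF B]
        continuous_on_compose2[OF W] continuous_intros)
  \<comment> \<open>Each of the two integrals changes by at most K C d, and 4 d K \<le> 1 makes the
    sum at most C/2.\<close>
  have diff: "norm (T W p - T V p) \<le> (1/2) * C"
    if W: "continuous_on UNIV W" and V: "continuous_on UNIV V" and C: "\<And>p. norm (W p - V p) \<le> C" for W V p C
  proof -
    have C0: "0 \<le> C"
      using C norm_ge_zero order_trans by blast
    have KC: "norm (h (X q) (W q) - h (X q) (V q)) \<le> K * C" if "X = A \<or> X = B" for X q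
    proof -
      have "norm (h (X q) (W q - V q)) \<le> K * norm (W q - V q)"
        using that bA[of q] bB[of q] by blast
      also have "\<dots> \<le> K * C"
        using C K by (intro mult_left_mono)
      finally show ?thesis
        by (simp add: bounded_bilinear.diff_right[OF h])
    qed
    let ?IA = "\<lambda>W. integral {u0..cu p} (\<lambda>s. h (A (s, v0)) (W (s, v0)))"
    let ?IB = "\<lambda>W. integral {v0..cv p} (\<lambda>t. h (B (cu p, t)) (W (cu p, t)))"
    have "norm (?IA W - ?IA V) \<le> K * C * (cu p - u0)"
      using KC cu[of p] by (subst integral_diff[symmetric])
        (auto intro!: integral_bound integrable_continuous_real sl W V continuous_intros)
    also have "\<dots> \<le> K * C * d"
      using cu[of p] K C0 by (intro mult_left_mono) auto
    finally have 1: "norm (?IA W - ?IA V) \<le> K * C * d" .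
    have "norm (?IB W - ?IB V) \<le> K * C * (cv p - v0)"
      using KC cv[of p] by (subst integral_diff[symmetric])
        (auto intro!: integral_bound integrable_continuous_real sl W V continuous_intros)
    also have "\<dots> \<le> K * C * d"
      using cv[of p] K C0 by (intro mult_left_mono) auto
    finally have 2: "norm (?IB W - ?IB V) \<le> K * C * d" .
    have "T W p - T V p = (?IA W - ?IA V) + (?IB W - ?IB V)"
      by (simp add: T_def)
    then have "norm (T W p - T V p) \<le> 2 * (K * C * d)"
      using 1 2 norm_triangle_ineq[of "?IA W - ?IA V" "?IB W - ?IB V"] by simp
    also have "\<dots> = (4 * (d * K)) * C / 2"
      by simp
    also have "\<dots> \<le> 1 * C / 2"
      using d C0 by (intro divide_right_mono mult_right_mono) auto
    finally show ?thesis
      by simp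
  qed
  \<comment> \<open>The image of 0 is constant, so comparison with it through \<open>diff\<close>
    shows that \<open>T\<close> preserves boundedness.\<close>
  have T0: "T (\<lambda>_. 0) p = w0" for p
    by (simp add: T_def bounded_bilinear.zero_right[OF h])
  have bc: "T W \<in> bcontfun" if W: "W \<in> bcontfun" for W
  proof -
    obtain C where "\<And>p. norm (W p) \<le> C"
      using W by (auto simp: bcontfun_def bounded_iff)
    moreover have cW: "continuous_on UNIV W"
      using W by (simp add: bcontfun_def)
    ultimately have "norm (T W p - w0) \<le> (1/2) * C" for p
      using diff[OF cW continuous_on_const[of _ 0], of C p] by (simp add: T0)
    then have "norm (T W p) \<le> (1/2) * C + norm w0" for p
      using norm_triangle_sub[of "T W p" w0] by (smt (verit, best))
    then show ?thesis
      by (intro bcontfun_normI[OF contT[OF cW]])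
  qed
  define \<Phi> where "\<Phi> W = Bcontfun (T (apply_bcontfun W))" for W
  have \<Phi>: "apply_bcontfun (\<Phi> W) p = T W p" for W p
    unfolding \<Phi>_def using bc[OF apply_bcontfun] by (simp add: Bcontfun_inverse)
  have "dist (\<Phi> W) (\<Phi> V) \<le> (1/2) * dist W V" for W V
  proof (rule dist_bound)
    fix p
    have "norm (W q - V q) \<le> dist W V" for q
      using dist_bounded[of W q V] by (simp add: dist_norm)
    then show "dist (\<Phi> W p) (\<Phi> V p) \<le> (1/2) * dist W V"
      using diff[of W V "dist W V" p] by (simp add: \<Phi> dist_norm)
  qed
  then obtain W where "\<Phi> W = W"
    using banach_fix_type[of "1/2" \<Phi>] by auto
  then have W: "T W p = W p" for p
    by (metis \<Phi>)
  show thesis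
  proof (rule that)
    show "continuous_on UNIV (apply_bcontfun W)"
      by simp
    fix u v assume "u \<in> {u0..u0+d}" "v \<in> {v0..v0+d}"
    then have "cu (u, v) = u" "cv (u, v) = v"
      by (auto simp: cu_def cv_def)
    then show "W (u, v) = w0 + integral {u0..u} (\<lambda>s. h (A (s, v0)) (W (s, v0))) + integral {v0..v} (\<lambda>t. h (B (u, t)) (W (u, t)))"
      using W[of "(u, v)"] by (simp add: T_def)
  qed
qed

text \<open>The difference \<open>R\<close> of \<open>W\<close> and the function \<open>Y\<close> obtained by integrating the first equation
  satisfies \<open>R\<^sub>v = B R - \<integral> B\<^sub>u R\<close> by flatness, and it vanishes at \<open>v = v0\<close>. On a small square the maximum of
  its norm is then bounded by a proper fraction of itself.\<close>

lemma goursat_solution_flat: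
  fixes A B A' B' :: "real \<times> real \<Rightarrow> 'a" and W :: "real \<times> real \<Rightarrow> 'b" and u0 v0 d :: real
  defines "Q \<equiv> {u0..u0+d} \<times> {v0..v0+d}"
  assumes A: "continuous_on UNIV A" and B: "continuous_on UNIV B" and W: "continuous_on UNIV W"
    and A': "continuous_on Q A'" and B': "continuous_on Q B'"
    and dA: "\<And>u v. (u, v) \<in> Q \<Longrightarrow> ((\<lambda>t. A (u, t)) has_vector_derivative A' (u, v)) (at v within {v0..v0+d})"
    and dB: "\<And>u v. (u, v) \<in> Q \<Longrightarrow> ((\<lambda>s. B (s, v)) has_vector_derivative B' (u, v)) (at u within {u0..u0+d})"
    and flat: "\<And>p w. p \<in> Q \<Longrightarrow> h (A' p) w + h (A p) (h (B p) w) = h (B' p) w + h (B p) (h (A p) w)"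
    and bB: "\<And>p w. p \<in> Q \<Longrightarrow> norm (h (B p) w) \<le> K * norm w"
    and bB': "\<And>p w. p \<in> Q \<Longrightarrow> norm (h (B' p) w) \<le> K * norm w"
    and d: "0 < d" "d * (K + K * d) < 1"
    and eq: "\<And>u v. (u, v) \<in> Q \<Longrightarrow> W (u, v) = w0 +
       integral {u0..u} (\<lambda>s. h (A (s, v0)) (W (s, v0))) + integral {v0..v} (\<lambda>t. h (B (u, t)) (W (u, t)))"
    and p: "(u, v) \<in> Q"
  shows "((\<lambda>t. W (u, t)) has_vector_derivative h (B (u, v)) (W (u, v))) (at v within {v0..v0+d})"
    "((\<lambda>s. W (s, v)) has_vector_derivative h (A (u, v)) (W (u, v))) (at u within {u0..u0+d})"
proof -
  note hc = bounded_bilinear.continuous_on[OF h]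
  have K: "0 \<le> K"
  proof -
    obtain b :: 'b where b: "b \<in> Basis"
      by fastforce
    have "(u0, v0) \<in> Q"
      using d by (simp add: Q_def)
    then show ?thesis
      using order_trans[OF norm_ge_zero bB[of _ b]] b by simp
  qed
  have sA: "continuous_on S (\<lambda>s. h (A (s, v)) (W (s, v)))" and sB: "continuous_on S (\<lambda>t. h (B (u, t)) (W (u, t)))" for S u v
    by (auto intro!: hc continuous_on_compose2[OF A] continuous_on_compose2[OF B]
        continuous_on_compose2[OF W] continuous_intros)
  have Wv: "((\<lambda>t. W (u, t)) has_vector_derivative h (B (u, v)) (W (u, v))) (at v within {v0..v0+d})"
    if "(u, v) \<in> Q" for u v
  proof -
    have "((\<lambda>t. (w0 + integral {u0..u} (\<lambda>s. h (A (s, v0)) (W (s, v0)))) + integral {v0..t} (\<lambda>t. h (B (u, t)) (W (u, t))))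
        has_vector_derivative 0 + h (B (u, v)) (W (u, v))) (at v within {v0..v0+d})"
      using that by (intro has_vector_derivative_add has_vector_derivative_const integral_has_vector_derivative sB)
        (auto simp: Q_def)
    then show ?thesis
      using that eq by (intro has_vector_derivative_transform[of v "{v0..v0+d}" "\<lambda>t. W (u, t)"]) (auto simp: Q_def)
  qed
  \<comment> \<open>\<open>Y\<close> equals \<open>W\<close> on the edge u = u0 and has u-derivative
    A W, so R = 0 is exactly the missing horizontal equation.\<close>
  define I where "I p = integral {u0..fst p} (\<lambda>s. h (A (s, snd p)) (W (s, snd p)))" for p
  define Y where "Y p = W (u0, snd p) + I p" for p
  define R where "R p = W p - Y p" for p
  define J where "J p = integral {u0..fst p} (\<lambda>s. h (B' (s, snd p)) (R (s, snd p)))" for p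
  have cI: "continuous_on Q I"
    unfolding I_def
    by (rule continuous_on_integral_upto)
      (auto simp: case_prod_beta Q_def intro!: hc continuous_on_compose2[OF A]
        continuous_on_compose2[OF W] continuous_intros)
  have cY: "continuous_on Q Y"
    unfolding Y_def using cI by (auto intro!: continuous_intros continuous_on_compose2[OF W])
  have cR: "continuous_on Q R"
    unfolding R_def using cY continuous_on_subset[OF W] by (auto intro!: continuous_intros)
  have slice: "continuous_on {u0..u} (\<lambda>s. f (s, v))" if "continuous_on Q f" "(u, v) \<in> Q"
    for u v and f :: "real \<times> real \<Rightarrow> 'c::topological_space"
    using that by (auto intro!: continuous_on_compose2[OF that(1)] continuous_intros simp: Q_def)
  have Yu: "((\<lambda>s. Y (s, v)) has_vector_derivative h (A (u, v)) (W (u, v))) (at u within {u0..u0+d})"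
    if "(u, v) \<in> Q" for u v
  proof -
    have "((\<lambda>s. W (u0, v) + integral {u0..s} (\<lambda>s. h (A (s, v)) (W (s, v))))
        has_vector_derivative 0 + h (A (u, v)) (W (u, v))) (at u within {u0..u0+d})"
      using that by (intro has_vector_derivative_add has_vector_derivative_const integral_has_vector_derivative sA)
        (auto simp: Q_def)
    then show ?thesis
      by (simp add: Y_def I_def)
  qed
  have Rv: "((\<lambda>t. R (u, t)) has_vector_derivative h (B (u, v)) (R (u, v)) - J (u, v)) (at v within {v0..v0+d})"
    if uv: "(u, v) \<in> Q" for u v
  proof -
    have u0v: "(u0, v) \<in> Q" and inQ: "\<And>s t. s \<in> {u0..u} \<Longrightarrow> t \<in> {v0..v0+d} \<Longrightarrow> (s, t) \<in> Q"
      using uv d by (auto simp: Q_def)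
    \<comment> \<open>This is the v-derivative A_v W + A B W of the integrand of \<open>I\<close>,
      rewritten by flatness.\<close>
    define g where "g s = h (B' (s, v)) (W (s, v)) + h (B (s, v)) (h (A (s, v)) (W (s, v)))" for s
    have Iv: "((\<lambda>t. I (u, t)) has_vector_derivative integral {u0..u} g) (at v within {v0..v0+d})"
    proof -
      let ?g = "\<lambda>t s. h (A (s, t)) (h (B (s, t)) (W (s, t))) + h (A' (s, t)) (W (s, t))"
      have "((\<lambda>t. integral (cbox u0 u) (\<lambda>s. h (A (s, t)) (W (s, t)))) has_vector_derivative integral (cbox u0 u) (?g v))
         (at v within {v0..v0+d})"
      proof (rule leibniz_rule_vector_derivative)
        fix t s assume "t \<in> {v0..v0+d}" "s \<in> cbox u0 u"
        then show "((\<lambda>t. h (A (s, t)) (W (s, t))) has_vector_derivative ?g t s) (at t within {v0..v0+d})"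
          using inQ[of s t] by (intro bounded_bilinear.has_vector_derivative[OF h] dA Wv) auto
      next
        show "(\<lambda>s. h (A (s, t)) (W (s, t))) integrable_on cbox u0 u" for t
          by (intro integrable_continuous sA)
        show "continuous_on ({v0..v0+d} \<times> cbox u0 u) (\<lambda>(t, s). ?g t s)"
          using inQ
          by (auto simp: case_prod_beta intro!: continuous_on_add hc continuous_on_compose2[OF A] continuous_on_compose2[OF B]
            continuous_on_compose2[OF W] continuous_on_compose2[OF A'] continuous_intros)
      qed (use uv in \<open>auto simp: Q_def\<close>)
      moreover have "integral (cbox u0 u) (?g v) = integral {u0..u} g"
        unfolding g_def using flat inQ uv
        by (auto intro!: integral_cong simp: Q_def add.commute)
      ultimately show ?thesis
        by (simp add: I_def)
    qed
    \<comment> \<open>B Y has u-derivative B A W + B_u Y. It differs from \<open>g\<close> only in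
      having Y in place of W under B_u, and this difference integrates to \<open>J\<close>.\<close>
    have "((\<lambda>s. h (B (s, v)) (h (A (s, v)) (W (s, v))) + h (B' (s, v)) (Y (s, v))) has_integral
        h (B (u, v)) (Y (u, v)) - h (B (u0, v)) (Y (u0, v))) {u0..u}"
    proof (rule fundamental_theorem_of_calculus)
      fix s assume "s \<in> {u0..u}"
      then have "(s, v) \<in> Q" "{u0..u} \<subseteq> {u0..u0+d}"
        using uv by (auto simp: Q_def)
      then show "((\<lambda>s. h (B (s, v)) (Y (s, v))) has_vector_derivative
          h (B (s, v)) (h (A (s, v)) (W (s, v))) + h (B' (s, v)) (Y (s, v))) (at s within {u0..u})"
        by (intro has_vector_derivative_within_subset[OF bounded_bilinear.has_vector_derivative[OF h dB Yu]])
    qed (use uv in \<open>auto simp: Q_def\<close>)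
    then have *: "integral {u0..u} (\<lambda>s. h (B (s, v)) (h (A (s, v)) (W (s, v))) + h (B' (s, v)) (Y (s, v)))
        = h (B (u, v)) (Y (u, v)) - h (B (u0, v)) (W (u0, v))"
      by (simp add: integral_unique Y_def I_def)
    have "integral {u0..u} g - integral {u0..u} (\<lambda>s. h (B (s, v)) (h (A (s, v)) (W (s, v))) + h (B' (s, v)) (Y (s, v))) = J (u, v)"
      unfolding J_def g_def
      by (subst integral_diff[symmetric])
        (auto intro!: integrable_continuous_real continuous_on_add hc slice[OF B' uv] slice[OF cY uv]
          continuous_on_compose2[OF A] continuous_on_compose2[OF B] continuous_on_compose2[OF W] continuous_intros
          integral_cong simp: R_def bounded_bilinear.diff_right[OF h])
    then have "integral {u0..u} g = h (B (u, v)) (Y (u, v)) - h (B (u0, v)) (W (u0, v)) + J (u, v)"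
      using * by (simp add: algebra_simps)
    then have "((\<lambda>t. W (u, t) - (W (u0, t) + I (u, t))) has_vector_derivative
       h (B (u, v)) (W (u, v)) - (h (B (u0, v)) (W (u0, v)) + (h (B (u, v)) (Y (u, v)) - h (B (u0, v)) (W (u0, v)) + J (u, v))))
       (at v within {v0..v0+d})"
      using Iv by (intro has_vector_derivative_diff has_vector_derivative_add Wv uv u0v) simp
    then show ?thesis
      by (simp add: R_def Y_def bounded_bilinear.diff_right[OF h] algebra_simps)
  qed
  have R0: "R p = 0" if p: "p \<in> Q" for p
  proof -
    have "compact Q" "Q \<noteq> {}"
      using d by (auto simp: Q_def intro!: compact_Times)
    then obtain q where q: "q \<in> Q" and max: "\<And>r. r \<in> Q \<Longrightarrow> norm (R r) \<le> norm (R q)"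
      using continuous_attains_sup[of Q "\<lambda>r. norm (R r)"] continuous_on_norm[OF cR] by metis
    obtain u v where uv: "q = (u, v)" "(u, v) \<in> Q"
      using q by (cases q) auto
    define M where "M = norm (R q)"
    have M0: "0 \<le> M"
      by (simp add: M_def)
    have le: "norm (h (B (u, t)) (R (u, t)) - J (u, t)) \<le> K * M + K * M * d" if t: "t \<in> {v0..v}" for t
    proof -
      have ut: "(u, t) \<in> Q" and st: "\<And>s. s \<in> {u0..u} \<Longrightarrow> (s, t) \<in> Q"
        using t uv by (auto simp: Q_def)
      have hR: "norm (h (X r) (R r)) \<le> K * M" if "r \<in> Q" "X = B \<or> X = B'" for r X
      proof -
        have "norm (h (X r) (R r)) \<le> K * norm (R r)"
          using that bB[of r] bB'[of r] by blast
        also have "\<dots> \<le> K * M"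
          using max[OF that(1)] K by (auto simp: M_def intro: mult_left_mono)
        finally show ?thesis .
      qed
      have "norm (J (u, t)) \<le> K * M * (u - u0)"
        unfolding J_def using ut hR st
        by (auto intro!: integral_bound hc slice[OF B' ut] slice[OF cR ut] simp: Q_def)
      also have "\<dots> \<le> K * M * d"
        using ut K M0 by (intro mult_left_mono) (auto simp: Q_def)
      finally show ?thesis
        using hR[OF ut, of B] norm_triangle_ineq4[of "h (B (u, t)) (R (u, t))" "J (u, t)"] by simp
    qed
    have "((\<lambda>t. h (B (u, t)) (R (u, t)) - J (u, t)) has_integral R (u, v) - R (u, v0)) {v0..v}"
      using uv by (intro fundamental_theorem_of_calculus has_vector_derivative_within_subset[OF Rv])
        (auto simp: Q_def)
    moreover have "R (u, v0) = 0"
      using eq[of u v0] eq[of u0 v0] uv d by (simp add: R_def Y_def I_def Q_def)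
    ultimately have "norm (R (u, v)) \<le> (K * M + K * M * d) * (v - v0)"
      using le K M0 d uv has_integral_bound_real[of "K * M + K * M * d" "{}"
        "\<lambda>t. h (B (u, t)) (R (u, t)) - J (u, t)" "R (u, v)" v0 v] by (simp add: Q_def)
    also have "\<dots> \<le> (K * M + K * M * d) * d"
      using uv K M0 d by (intro mult_left_mono) (auto simp: Q_def)
    also have "\<dots> = (d * (K + K * d)) * M"
      by (simp add: algebra_simps)
    finally have "M \<le> (d * (K + K * d)) * M"
      by (simp add: M_def uv)
    then have "M = 0"
      using d M0 by (smt (verit, best) mult_le_cancel_right1)
    then show ?thesis
      using max[OF p] by (simp add: M_def)
  qed
  show "((\<lambda>t. W (u, t)) has_vector_derivative h (B (u, v)) (W (u, v))) (at v within {v0..v0+d})"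
    using Wv p by simp
  have "W (s, v) = Y (s, v)" if "s \<in> {u0..u0+d}" for s
    using R0[of "(s, v)"] that p by (simp add: R_def Q_def)
  then show "((\<lambda>s. W (s, v)) has_vector_derivative h (A (u, v)) (W (u, v))) (at u within {u0..u0+d})"
    using p by (intro has_vector_derivative_transform[OF _ _ Yu[OF p]]) (auto simp: Q_def)
qed

lemma bilinear_bound_on_compact:
  assumes "compact S" "continuous_on S A"
  obtains K where "0 \<le> K" "\<And>p w. p \<in> S \<Longrightarrow> norm (h (A p) w) \<le> K * norm w"
proof -
  obtain N where N: "\<And>p. p \<in> S \<Longrightarrow> norm (A p) \<le> N"
    using compact_imp_bounded[OF compact_continuous_image[OF assms(2,1)]] by (auto simp: bounded_iff)
  obtain C where C: "0 < C" "\<And>a w. norm (h a w) \<le> norm a * norm w * C"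
    using bounded_bilinear.pos_bounded[OF h] by blast
  have "norm (h (A p) w) \<le> (\<bar>N\<bar> * C) * norm w" if "p \<in> S" for p w
  proof -
    have "norm (h (A p) w) \<le> norm (A p) * (norm w * C)"
      using C(2)[of "A p" w] by (simp add: mult.assoc)
    also have "\<dots> \<le> \<bar>N\<bar> * (norm w * C)"
      using N[OF that] C(1) by (intro mult_right_mono) auto
    finally show ?thesis
      by (simp add: mult_ac)
  qed
  then show thesis
    using C(1) by (intro that[of "\<bar>N\<bar> * C"]) auto
qed

text \<open>The initial point is a corner of the square, and two-sided derivatives are available in
  the interior only. Continuity of \<open>W\<close> on the whole plane keeps the initial value
  linked to the interior.\<close>

lemma flat_linear_system_solvable:
  fixes A B A' B' :: "real \<times> real \<Rightarrow> 'a" and w0 :: 'b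
  assumes D: "open D" "(u0, v0) \<in> D"
    and cont: "continuous_on D A" "continuous_on D B" "continuous_on D A'" "continuous_on D B'"
    and dA: "\<And>p. p \<in> D \<Longrightarrow> has_pd False A (A' p) p" and dB: "\<And>p. p \<in> D \<Longrightarrow> has_pd True B (B' p) p"
    and flat: "\<And>p w. p \<in> D \<Longrightarrow> h (A' p) w + h (A p) (h (B p) w) = h (B' p) w + h (B p) (h (A p) w)"
  obtains d W where "0 < d" "{u0..u0+d} \<times> {v0..v0+d} \<subseteq> D" "continuous_on UNIV W" "W (u0, v0) = w0"
    "\<And>p. p \<in> {u0<..<u0+d} \<times> {v0<..<v0+d} \<Longrightarrow> has_pd True W (h (A p) (W p)) p"
    "\<And>p. p \<in> {u0<..<u0+d} \<times> {v0<..<v0+d} \<Longrightarrow> has_pd False W (h (B p) (W p)) p"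
proof -
  obtain U V where UV: "open U" "open V" "u0 \<in> U" "v0 \<in> V" "U \<times> V \<subseteq> D"
    using D by (rule open_prod_elim) auto
  obtain e1 e2 where e: "0 < e1" "cball u0 e1 \<subseteq> U" "0 < e2" "cball v0 e2 \<subseteq> V"
    using UV by (meson open_contains_cball)
  define e where "e = min e1 e2"
  define S where "S = {u0..u0+e} \<times> {v0..v0+e}"
  have e0: "0 < e" and SD: "S \<subseteq> D"
    using e UV(5) by (auto simp: e_def S_def dist_real_def subset_iff)
  have cS: "compact S"
    by (auto simp: S_def intro!: compact_Times)
  obtain K1 where K1: "0 \<le> K1" "\<And>p w. p \<in> S \<Longrightarrow> norm (h (A p) w) \<le> K1 * norm w"
    using bilinear_bound_on_compact[OF cS continuous_on_subset[OF cont(1) SD]] by blast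
  obtain K2 where K2: "0 \<le> K2" "\<And>p w. p \<in> S \<Longrightarrow> norm (h (B p) w) \<le> K2 * norm w"
    using bilinear_bound_on_compact[OF cS continuous_on_subset[OF cont(2) SD]] by blast
  obtain K3 where K3: "0 \<le> K3" "\<And>p w. p \<in> S \<Longrightarrow> norm (h (B' p) w) \<le> K3 * norm w"
    using bilinear_bound_on_compact[OF cS continuous_on_subset[OF cont(4) SD]] by blast
  define K where "K = K1 + K2 + K3 + 1"
  have K: "1 \<le> K" "K1 \<le> K" "K2 \<le> K" "K3 \<le> K"
    using K1(1) K2(1) K3(1) by (auto simp: K_def)
  have bd: "norm (h (A p) w) \<le> K * norm w" "norm (h (B p) w) \<le> K * norm w" "norm (h (B' p) w) \<le> K * norm w"
    if "p \<in> S" for p w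
    using K1(2)[OF that, of w] K2(2)[OF that, of w] K3(2)[OF that, of w] K
    by (meson order_trans mult_right_mono norm_ge_zero)+
  \<comment> \<open>d K \<le> 1/4 is the contraction condition. As K \<ge> 1, also d \<le> 1/4,
    hence d (K + K d) \<le> 1/4 + 1/16 < 1 as needed for the flatness argument.\<close>
  define d where "d = min e (1 / (4 * K))"
  have d: "0 < d" "d \<le> e" "d * K \<le> 1/4"
  proof -
    have "d * K \<le> 1 / (4 * K) * K"
      using K by (intro mult_right_mono) (auto simp: d_def)
    then show "d * K \<le> 1/4"
      using K by simp
  qed (use e0 K in \<open>auto simp: d_def\<close>)
  have d2: "d * (K + K * d) < 1"
  proof -
    have "d * 1 \<le> d * K"
      using d K by (intro mult_left_mono) auto
    then have "d \<le> 1/4"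
      using d(3) by linarith
    then have "d * K * d \<le> 1/4 * (1/4)"
      using d K by (intro mult_mono) auto
    then show ?thesis
      using d(3) by (simp add: algebra_simps)
  qed
  define Q where "Q = {u0..u0+d} \<times> {v0..v0+d}"
  have QS: "Q \<subseteq> S"
    using d by (auto simp: Q_def S_def)
  \<comment> \<open>Composition with this retraction onto the square extends the coefficients
    continuously and with the same bounds to the plane.\<close>
  define c where "c p = (max u0 (min (fst p) (u0+d)), max v0 (min (snd p) (v0+d)))" for p :: "real \<times> real"
  have c: "c p \<in> Q" "p \<in> Q \<Longrightarrow> c p = p" for p
    using d by (auto simp: c_def Q_def)
  have cc: "continuous_on UNIV c"
    unfolding c_def by (auto intro!: continuous_intros)
  have cA: "continuous_on UNIV (\<lambda>p. A (c p))" and cB: "continuous_on UNIV (\<lambda>p. B (c p))"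
  proof -
    have "range c \<subseteq> D"
      using c(1) QS SD by blast
    then show "continuous_on UNIV (\<lambda>p. A (c p))" "continuous_on UNIV (\<lambda>p. B (c p))"
      using continuous_on_compose2[OF cont(1) cc] continuous_on_compose2[OF cont(2) cc] by blast+
  qed
  have bdc: "norm (h (A (c p)) w) \<le> K * norm w" "norm (h (B (c p)) w) \<le> K * norm w" for p w
    using bd c(1) QS by blast+
  obtain W where W: "continuous_on UNIV W" and
    eqW: "\<And>u v. u \<in> {u0..u0+d} \<Longrightarrow> v \<in> {v0..v0+d} \<Longrightarrow> W (u, v) = w0 +
       integral {u0..u} (\<lambda>s. h (A (c (s, v0))) (W (s, v0))) + integral {v0..v} (\<lambda>t. h (B (c (u, t))) (W (u, t)))"
    using goursat_integral_equation[OF cA cB _ _ d(1), of K u0 v0 w0] bdc d(3) by auto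
  have slice: "((\<lambda>t. A (c (u, t))) has_vector_derivative A' (u, v)) (at v within {v0..v0+d})"
    "((\<lambda>s. B (c (s, v))) has_vector_derivative B' (u, v)) (at u within {u0..u0+d})"
    if "(u, v) \<in> Q" for u v
  proof -
    have "(u, v) \<in> D"
      using that QS SD by auto
    then have "((\<lambda>t. A (u, t)) has_vector_derivative A' (u, v)) (at v within {v0..v0+d})"
      "((\<lambda>s. B (s, v)) has_vector_derivative B' (u, v)) (at u within {u0..u0+d})"
      using dA[of "(u, v)"] dB[of "(u, v)"]
      by (auto simp: has_pd_def move_def coord_def intro: has_vector_derivative_at_within)
    then show "((\<lambda>t. A (c (u, t))) has_vector_derivative A' (u, v)) (at v within {v0..v0+d})"
      "((\<lambda>s. B (c (s, v))) has_vector_derivative B' (u, v)) (at u within {u0..u0+d})"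
      using that c by (auto simp: Q_def intro: has_vector_derivative_transform[rotated 2])
  qed
  have sol: "((\<lambda>t. W (u, t)) has_vector_derivative h (B (c (u, v))) (W (u, v))) (at v within {v0..v0+d})"
    "((\<lambda>s. W (s, v)) has_vector_derivative h (A (c (u, v))) (W (u, v))) (at u within {u0..u0+d})"
    if "(u, v) \<in> Q" for u v
  proof -
    have QD: "Q \<subseteq> D"
      using QS SD by blast
    have flat': "h (A' p) w + h (A (c p)) (h (B (c p)) w) = h (B' p) w + h (B (c p)) (h (A (c p)) w)" if "p \<in> Q" for p w
      using flat[of p w] c(2)[OF that] that QD by auto
    have bd': "norm (h (B' p) w) \<le> K * norm w" if "p \<in> Q" for p w
      using bd(3) that QS by blast
    have eq': "W (u, v) = w0 + integral {u0..u} (\<lambda>s. h (A (c (s, v0))) (W (s, v0))) +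
       integral {v0..v} (\<lambda>t. h (B (c (u, t))) (W (u, t)))" if "(u, v) \<in> Q" for u v
      using eqW that by (auto simp: Q_def)
    show "((\<lambda>t. W (u, t)) has_vector_derivative h (B (c (u, v))) (W (u, v))) (at v within {v0..v0+d})"
      "((\<lambda>s. W (s, v)) has_vector_derivative h (A (c (u, v))) (W (u, v))) (at u within {u0..u0+d})"
      using goursat_solution_flat[OF cA cB W, of u0 d v0 A' B' K w0 u v, folded Q_def,
          OF continuous_on_subset[OF cont(3) QD] continuous_on_subset[OF cont(4) QD] slice flat' bdc(2) bd' d(1) d2 eq' that]
      by auto
  qed
  show thesis
  proof (rule that[of d W])
    show "{u0..u0+d} \<times> {v0..v0+d} \<subseteq> D"
      using QS SD by (auto simp: Q_def)
    show "W (u0, v0) = w0"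
      using eqW[of u0 v0] d by simp
    fix p assume p: "p \<in> {u0<..<u0+d} \<times> {v0<..<v0+d}"
    then obtain u v where uv: "p = (u, v)" "u \<in> {u0<..<u0+d}" "v \<in> {v0<..<v0+d}"
      by auto
    then have pQ: "(u, v) \<in> Q"
      by (auto simp: Q_def)
    show "has_pd True W (h (A p) (W p)) p" "has_pd False W (h (B p) (W p)) p"
      using sol[OF pQ] c(2)[OF pQ] uv by (auto simp: has_pd_def move_def coord_def at_within_Icc_at)
  qed (use d W in auto)
qed

end

section \<open>Mixed partial derivatives and matrix calculus\<close>

lemma open_rectangle_inside:
  assumes "open D" "(u1, v1) \<in> D"
  obtains e :: real where "0 < e" "{u1-e..u1+e} \<times> {v1-e..v1+e} \<subseteq> (D :: (real \<times> real) set)"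
proof -
  obtain U V where UV: "open U" "open V" "u1 \<in> U" "v1 \<in> V" "U \<times> V \<subseteq> D"
    using assms by (rule open_prod_elim) auto
  obtain e1 e2 where e: "0 < e1" "cball u1 e1 \<subseteq> U" "0 < e2" "cball v1 e2 \<subseteq> V"
    using UV by (meson open_contains_cball)
  show thesis
  proof (rule that[of "min e1 e2"])
    show "{u1 - min e1 e2..u1 + min e1 e2} \<times> {v1 - min e1 e2..v1 + min e1 e2} \<subseteq> D"
    proof -
      have "{u1 - min e1 e2..u1 + min e1 e2} \<subseteq> U" "{v1 - min e1 e2..v1 + min e1 e2} \<subseteq> V"
        using e by (auto simp: cball_eq_atLeastAtMost elim!: subsetD)
      then show ?thesis
        using UV(5) by blast
    qed
  qed (use e in auto)
qed

text \<open>Differences of f in u are integrals of \<open>fu\<close>. Differentiating them in v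
  under the integral writes \<open>fv\<close> as a constant plus an integral of \<open>fuv\<close>,
  which the fundamental theorem differentiates in u.\<close>

lemma mixed_partials_commute:
  fixes f :: "real \<times> real \<Rightarrow> 'a::euclidean_space"
  assumes D: "open D" and p: "p \<in> D"
    and fu: "\<And>q. q \<in> D \<Longrightarrow> has_pd True f (fu q) q" and fv: "\<And>q. q \<in> D \<Longrightarrow> has_pd False f (fv q) q"
    and fuv: "\<And>q. q \<in> D \<Longrightarrow> has_pd False fu (fuv q) q" and cont: "continuous_on D fuv"
  shows "has_pd True fv (fuv p) p"
proof -
  obtain u1 v1 where uv: "p = (u1, v1)"
    by (cases p)
  obtain e where e: "0 < e" "{u1-e..u1+e} \<times> {v1-e..v1+e} \<subseteq> D"
    using open_rectangle_inside[OF D] p uv by blast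
  let ?U = "{u1-e..u1+e}" and ?V = "{v1-e..v1+e}"
  have inD: "(s, t) \<in> D" if "s \<in> ?U" "t \<in> ?V" for s t
    using that e by auto
  have int: "((\<lambda>s. fu (s, t)) has_integral f (u, t) - f (u1-e, t)) {u1-e..u}" if "u \<in> ?U" "t \<in> ?V" for u t
  proof (rule fundamental_theorem_of_calculus)
    fix s assume "s \<in> {u1-e..u}"
    then show "((\<lambda>s. f (s, t)) has_vector_derivative fu (s, t)) (at s within {u1-e..u})"
      using fu[OF inD, of s t] that
      by (auto simp: has_pd_def move_def coord_def intro: has_vector_derivative_at_within)
  qed (use that in auto)
  have fv_eq: "fv (u, v1) = fv (u1-e, v1) + integral {u1-e..u} (\<lambda>s. fuv (s, v1))" if u: "u \<in> ?U" for u
  proof -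
    have "((\<lambda>t. integral (cbox (u1-e) u) (\<lambda>s. fu (s, t))) has_vector_derivative
        integral (cbox (u1-e) u) (\<lambda>s. fuv (s, v1))) (at v1 within ?V)"
    proof (rule leibniz_rule_vector_derivative)
      fix t s assume "t \<in> ?V" "s \<in> cbox (u1-e) u"
      then show "((\<lambda>t. fu (s, t)) has_vector_derivative fuv (s, t)) (at t within ?V)"
        using fuv[OF inD, of s t] u
        by (auto simp: has_pd_def move_def coord_def intro: has_vector_derivative_at_within)
    next
      show "(\<lambda>s. fu (s, t)) integrable_on cbox (u1-e) u" if "t \<in> ?V" for t
        using int[OF u that] by (auto simp: integrable_on_def)
      show "continuous_on (?V \<times> cbox (u1-e) u) (\<lambda>(t, s). fuv (s, t))"
        using u inD by (auto simp: case_prod_beta intro!: continuous_on_compose2[OF cont] continuous_intros)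
    qed (use e in auto)
    moreover have "f (u, t) - f (u1-e, t) = integral (cbox (u1-e) u) (\<lambda>s. fu (s, t))" if "t \<in> ?V" for t
      using int[OF u that] by (simp add: integral_unique)
    moreover have "v1 \<in> ?V"
      using e by simp
    ultimately have "((\<lambda>t. f (u, t) - f (u1-e, t)) has_vector_derivative
        integral {u1-e..u} (\<lambda>s. fuv (s, v1))) (at v1 within ?V)"
      by (metis (mono_tags, lifting) has_vector_derivative_transform box_real(2))
    then have 1: "((\<lambda>t. f (u, t) - f (u1-e, t)) has_vector_derivative
        integral {u1-e..u} (\<lambda>s. fuv (s, v1))) (at v1)"
      using e by (simp add: at_within_Icc_at)
    have 2: "((\<lambda>t. f (u, t) - f (u1-e, t)) has_vector_derivative fv (u, v1) - fv (u1-e, v1)) (at v1)"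
      using fv[OF inD, of u v1] fv[OF inD, of "u1-e" v1] u e
      by (intro has_vector_derivative_diff) (auto simp: has_pd_def move_def coord_def)
    show ?thesis
      using vector_derivative_unique_at[OF 1 2] by (simp add: algebra_simps)
  qed
  have "((\<lambda>u. fv (u1-e, v1) + integral {u1-e..u} (\<lambda>s. fuv (s, v1))) has_vector_derivative 0 + fuv (u1, v1)) (at u1 within ?U)"
    using e inD by (intro has_vector_derivative_add has_vector_derivative_const integral_has_vector_derivative)
      (auto intro!: continuous_on_compose2[OF cont] continuous_intros)
  then have "((\<lambda>u. fv (u, v1)) has_vector_derivative fuv (u1, v1)) (at u1 within ?U)"
    using e by (intro has_vector_derivative_transform[OF _ fv_eq]) auto
  then show ?thesis
    using e by (simp add: uv has_pd_def move_def coord_def at_within_Icc_at)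
qed

lemma smooth_on_pd_commute:
  fixes f :: "real \<times> real \<Rightarrow> 'a::euclidean_space"
  assumes D: "open D" and f: "smooth_on D f" and p: "p \<in> D"
  shows "pd True (pd False f) p = pd False (pd True f) p"
proof -
  have "has_pd True (pd False f) (pd False (pd True f) p) p"
    by (rule mixed_partials_commute[OF D p])
      (use f in \<open>auto intro: smooth_on_has_pd smooth_on_pd smooth_on_continuous\<close>)
  then show ?thesis
    by (rule has_pd_imp_pd)
qed

text \<open>In a small rectangle each point is joined to the centre by a horizontal and a vertical
  segment; connectedness of D then makes local constancy global.\<close>

lemma zero_pd_imp_constant:
  assumes D: "open D" "connected D" and z: "\<And>b p. p \<in> D \<Longrightarrow> has_pd b f 0 p" and pq: "p \<in> D" "q \<in> D"
  shows "f p = f q"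
proof -
  have "f constant_on D"
  proof (rule locally_constant_imp_constant[OF D(2)])
    fix r assume r: "r \<in> D"
    obtain u1 v1 where uv: "r = (u1, v1)"
      by (cases r)
    obtain e where e: "0 < e" "{u1-e..u1+e} \<times> {v1-e..v1+e} \<subseteq> D"
      using open_rectangle_inside[OF D(1)] r uv by blast
    have eq: "f (u, v) = f r" if "u \<in> {u1-e..u1+e}" "v \<in> {v1-e..v1+e}" for u v
    proof -
      have "((\<lambda>s. f (s, v)) has_vector_derivative 0) (at s within {u1-e..u1+e})" if "s \<in> {u1-e..u1+e}" for s
      proof -
        have "(s, v) \<in> D"
          using that \<open>v \<in> _\<close> e by auto
        then show ?thesis
          using z[of "(s, v)" True] by (auto simp: has_pd_def move_def coord_def intro: has_vector_derivative_at_within)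
      qed
      then obtain c1 where c1: "\<And>s. s \<in> {u1-e..u1+e} \<Longrightarrow> f (s, v) = c1"
        using has_vector_derivative_zero_constant[of "{u1-e..u1+e}" "\<lambda>s. f (s, v)"] by auto
      have "((\<lambda>t. f (u1, t)) has_vector_derivative 0) (at t within {v1-e..v1+e})" if "t \<in> {v1-e..v1+e}" for t
      proof -
        have "(u1, t) \<in> D"
          using that e by auto
        then show ?thesis
          using z[of "(u1, t)" False] by (auto simp: has_pd_def move_def coord_def intro: has_vector_derivative_at_within)
      qed
      then obtain c2 where c2: "\<And>t. t \<in> {v1-e..v1+e} \<Longrightarrow> f (u1, t) = c2"
        using has_vector_derivative_zero_constant[of "{v1-e..v1+e}" "\<lambda>t. f (u1, t)"] by auto
      have "f (u, v) = f (u1, v)" "f (u1, v) = f (u1, v1)"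
        using c1[of u] c1[of u1] c2[of v] c2[of v1] that e by simp_all
      then show ?thesis
        by (simp add: uv)
    qed
    let ?T = "{u1-e<..<u1+e} \<times> {v1-e<..<v1+e}"
    have "openin (top_of_set D) ?T" "r \<in> ?T"
      using e by (auto simp: uv openin_open_eq[OF D(1)] open_Times subset_iff)
    moreover have "\<forall>x\<in>?T. f x = f r"
      using eq by auto
    ultimately show "\<exists>T. openin (top_of_set D) T \<and> r \<in> T \<and> (\<forall>x\<in>T. f x = f r)"
      by blast
  qed
  then show ?thesis
    using pq by (auto simp: constant_on_def)
qed

section \<open>Matrix operations as bounded linear and bilinear maps\<close>

lemma vector_4 [simp]:
  "(vector [x, y, z, w] :: 'a::zero ^ 4) $ 1 = x" "(vector [x, y, z, w] :: 'a ^ 4) $ 2 = y"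
  "(vector [x, y, z, w] :: 'a ^ 4) $ 3 = z" "(vector [x, y, z, w] :: 'a ^ 4) $ 4 = w"
  by (simp_all add: vector_def)

lemma bounded_bilinear_matrix_mult:
  "bounded_bilinear ((**) :: real^'n^'m \<Rightarrow> real^'p^'n \<Rightarrow> real^'p^'m)"
  unfolding bilinear_conv_bounded_bilinear[symmetric] bilinear_def
  by (auto intro!: linearI simp: vec_eq_iff matrix_matrix_mult_def sum.distrib sum_distrib_left algebra_simps)

lemma bounded_bilinear_vector_matrix_mult:
  "bounded_bilinear ((v*) :: real^'m \<Rightarrow> real^'n^'m \<Rightarrow> real^'n)"
  unfolding bilinear_conv_bounded_bilinear[symmetric] bilinear_def
  by (auto intro!: linearI simp: vec_eq_iff vector_matrix_mult_def sum.distrib sum_distrib_left algebra_simps)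

lemma bounded_linear_transpose: "bounded_linear (transpose :: real^'n^'m \<Rightarrow> real^'m^'n)"
  unfolding linear_conv_bounded_linear[symmetric]
  by (auto intro!: linearI simp: vec_eq_iff transpose_def)

lemma continuous_on_det: "continuous_on S (det :: real^'n^'n \<Rightarrow> real)"
  unfolding det_def by (intro continuous_intros bounded_linear.continuous_on[OF bounded_linear_vec_nth])

lemma has_real_derivative_ln_abs: "x \<noteq> 0 \<Longrightarrow> ((\<lambda>x. ln \<bar>x\<bar>) has_real_derivative 1 / x) (at x)"
proof -
  assume "x \<noteq> 0"
  then have "((\<lambda>x. ln (x\<^sup>2) / 2) has_real_derivative 1 / x) (at x)"
    by (auto intro!: derivative_eq_intros simp: power2_eq_square mult_neg_neg neq_iff)
  moreover have "ln (x\<^sup>2) / 2 = ln \<bar>x\<bar>" for x :: real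
    using ln_realpow[of "\<bar>x\<bar>" 2] by (cases "x = 0") auto
  ultimately show ?thesis
    by simp
qed

section \<open>The structure equations\<close>

lemma smooth_on_const: "open D \<Longrightarrow> smooth_on D (\<lambda>q. c)"
  by (simp add: smooth_on_iff_Ck Ck_const)

lemma smooth_on_add: "open D \<Longrightarrow> smooth_on D f \<Longrightarrow> smooth_on D g \<Longrightarrow> smooth_on D (\<lambda>q. f q + g q)"
  by (simp add: smooth_on_iff_Ck Ck_add)

lemma smooth_on_linear: "open D \<Longrightarrow> bounded_linear h \<Longrightarrow> smooth_on D f \<Longrightarrow> smooth_on D (\<lambda>q. h (f q))"
  by (simp add: smooth_on_iff_Ck Ck_linear)

lemma smooth_on_bilinear:
  "open D \<Longrightarrow> bounded_bilinear h \<Longrightarrow> smooth_on D f \<Longrightarrow> smooth_on D g \<Longrightarrow> smooth_on D (\<lambda>q. h (f q) (g q))"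
  by (simp add: smooth_on_iff_Ck Ck_bilinear)

lemmas smooth_on_mult = smooth_on_bilinear[OF _ bounded_bilinear_mult]
lemmas smooth_on_scaleR = smooth_on_bilinear[OF _ bounded_bilinear_scaleR]
lemmas smooth_on_minus = smooth_on_linear[OF _ bounded_linear_minus[OF bounded_linear_ident]]

lemma smooth_on_diff: "open D \<Longrightarrow> smooth_on D f \<Longrightarrow> smooth_on D g \<Longrightarrow> smooth_on D (\<lambda>q. f q - g q)"
  using smooth_on_add[of D f "\<lambda>q. - g q"] smooth_on_minus[of D g] by simp

lemma smooth_on_divide:
  fixes f g :: "real \<times> real \<Rightarrow> real"
  assumes "open D" "\<And>p. p \<in> D \<Longrightarrow> g p \<noteq> 0" "smooth_on D f" "smooth_on D g"
  shows "smooth_on D (\<lambda>q. f q / g q)"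
  unfolding divide_inverse using assms
  by (intro smooth_on_mult) (auto simp: smooth_on_iff_Ck intro: Ck_inverse)

lemma smooth_on_vec:
  fixes f :: "real \<times> real \<Rightarrow> 'a::euclidean_space ^ 'n"
  shows "open D \<Longrightarrow> (\<And>i. smooth_on D (\<lambda>q. f q $ i)) \<Longrightarrow> smooth_on D f"
  by (simp add: smooth_on_iff_Ck Ck_vec)

text \<open>Serves logarithms: their partial derivatives are rational in functions already known to
  be smooth, so continuity is all that remains to be checked for the logarithm itself.\<close>

lemma smooth_on_if_pd_smooth:
  assumes D: "open D" and f: "continuous_on D f" and pd: "\<And>b p. p \<in> D \<Longrightarrow> has_pd b f (g b p) p"
    and g: "\<And>b. smooth_on D (g b)"
  shows "smooth_on D f"
proof -
  have "Ck (Suc k) D f" for k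
    unfolding Ck.simps using f pd g by (auto simp: smooth_on_iff_Ck[OF D] intro!: exI[of _ "g _"])
  then show ?thesis
    using smooth_on_iff_Ck[OF D] Ck_Suc_imp by blast
qed

lemma smooth_on_linear_system:
  assumes "open D" "bounded_bilinear h" "\<And>b. smooth_on D (a b)" "continuous_on D f"
    and "\<And>b p. p \<in> D \<Longrightarrow> has_pd b f (h (a b p) (f p)) p"
  shows "smooth_on D f"
  using assms Ck_linear_system[OF assms(2), of D a f] by (simp add: smooth_on_iff_Ck)

text \<open>The frame with rows \<open>x, y, n1, n2\<close> and the position vector \<open>z\<close> satisfy \<open>W\<^sub>u = conn True \<dots> ** W\<close>,
  \<open>W\<^sub>v = conn False \<dots> ** W\<close>, \<open>z\<^sub>u = tang True \<lambda> v* W\<close> and \<open>z\<^sub>v = tang False \<lambda> v* W\<close>, where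
  \<open>\<lambda> = sqrt E = sqrt G\<close>, \<open>a = \<lambda> \<nu>\<close>, \<open>m = \<lambda> \<mu>\<close> and \<open>(g, t)\<close> is \<open>\<lambda> (\<gamma>\<^sub>1, - \<beta>\<^sub>1)\<close> for \<open>True\<close> and
  \<open>\<lambda> (\<gamma>\<^sub>2, \<beta>\<^sub>2)\<close> for \<open>False\<close>.\<close>

definition conn :: "bool \<Rightarrow> real \<Rightarrow> real \<Rightarrow> real \<Rightarrow> real \<Rightarrow> real^4^4" where
  "conn b g t a m = (if b
     then vector [vector [0, g, a, 0], vector [-g, 0, 0, m], vector [-a, 0, 0, -t], vector [0, -m, t, 0]]
     else vector [vector [0, -g, 0, m], vector [g, 0, -a, 0], vector [0, a, 0, t], vector [-m, 0, -t, 0]])"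

definition tang :: "bool \<Rightarrow> real \<Rightarrow> real^4" where
  "tang b l = (if b then vector [l, 0, 0, 0] else vector [0, l, 0, 0])"

lemma has_pd_minus: "has_pd b f d p \<Longrightarrow> has_pd b (\<lambda>q. - f q) (- d) p"
  by (rule has_pd_linear[OF bounded_linear_minus[OF bounded_linear_ident]])

text \<open>\<open>conn\<close> is linear in its four scalar arguments, so differentiation passes to
  them.\<close>

lemma has_pd_conn:
  assumes "has_pd b g g' p" "has_pd b t t' p" "has_pd b a a' p" "has_pd b m m' p"
  shows "has_pd b (\<lambda>q. conn c (g q) (t q) (a q) (m q)) (conn c g' t' a' m') p"
proof (intro has_pd_vec)
  fix i j :: 4
  have "\<forall>i j. has_pd b (\<lambda>q. conn c (g q) (t q) (a q) (m q) $ i $ j) (conn c g' t' a' m' $ i $ j) p"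
    using assms by (cases c) (simp_all add: conn_def forall_4 has_pd_const has_pd_minus)
  then show "has_pd b (\<lambda>q. conn c (g q) (t q) (a q) (m q) $ i $ j) (conn c g' t' a' m' $ i $ j) p"
    by blast
qed

lemma has_pd_tang: "has_pd b l l' p \<Longrightarrow> has_pd b (\<lambda>q. tang c (l q)) (tang c l') p"
proof (intro has_pd_vec)
  fix i :: 4
  assume "has_pd b l l' p"
  then have "\<forall>i. has_pd b (\<lambda>q. tang c (l q) $ i) (tang c l' $ i) p"
    by (cases c) (simp_all add: tang_def forall_4 has_pd_const)
  then show "has_pd b (\<lambda>q. tang c (l q) $ i) (tang c l' $ i) p"
    by blast
qed

lemma smooth_on_conn:
  assumes D: "open D" and "smooth_on D g" "smooth_on D t" "smooth_on D a" "smooth_on D m"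
  shows "smooth_on D (\<lambda>q. conn c (g q) (t q) (a q) (m q))"
proof (intro smooth_on_vec D)
  fix i j :: 4
  have "\<forall>i j. smooth_on D (\<lambda>q. conn c (g q) (t q) (a q) (m q) $ i $ j)"
    using assms by (cases c) (simp_all add: conn_def forall_4 smooth_on_const smooth_on_minus)
  then show "smooth_on D (\<lambda>q. conn c (g q) (t q) (a q) (m q) $ i $ j)"
    by blast
qed

lemma smooth_on_tang:
  assumes D: "open D" and "smooth_on D l"
  shows "smooth_on D (\<lambda>q. tang c (l q))"
proof (intro smooth_on_vec D)
  fix i :: 4
  have "\<forall>i. smooth_on D (\<lambda>q. tang c (l q) $ i)"
    using assms by (cases c) (simp_all add: tang_def forall_4 smooth_on_const)
  then show "smooth_on D (\<lambda>q. tang c (l q) $ i)"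
    by blast
qed

lemma transpose_conn: "transpose (conn b g t a m) = - conn b g t a m"
  by (cases b) (simp_all add: vec_eq_iff transpose_def conn_def forall_4)

lemma conn_rows:
  fixes W :: "real^4^4"
  shows
  "(conn True g t a m ** W) $ 1 = g *\<^sub>R W $ 2 + a *\<^sub>R W $ 3"
  "(conn True g t a m ** W) $ 2 = - g *\<^sub>R W $ 1 + m *\<^sub>R W $ 4"
  "(conn True g t a m ** W) $ 3 = - a *\<^sub>R W $ 1 - t *\<^sub>R W $ 4"
  "(conn True g t a m ** W) $ 4 = - m *\<^sub>R W $ 2 + t *\<^sub>R W $ 3"
  "(conn False g t a m ** W) $ 1 = - g *\<^sub>R W $ 2 + m *\<^sub>R W $ 4"
  "(conn False g t a m ** W) $ 2 = g *\<^sub>R W $ 1 - a *\<^sub>R W $ 3"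
  "(conn False g t a m ** W) $ 3 = a *\<^sub>R W $ 2 + t *\<^sub>R W $ 4"
  "(conn False g t a m ** W) $ 4 = - m *\<^sub>R W $ 1 - t *\<^sub>R W $ 3"
  by (simp_all add: vec_eq_iff matrix_matrix_mult_def sum_4 conn_def)

lemma tang_mult:
  fixes W :: "real^4^4"
  shows "tang b l v* W = l *\<^sub>R W $ (if b then 1 else 2)"
  by (simp add: vec_eq_iff vector_matrix_mult_def sum_4 tang_def)

text \<open>These conditions pass to open subsets, so existence on a small square and uniqueness on
  a subdomain are both statements about instances of the locale.\<close>

locale invariant_pair =
  fixes D :: "(real \<times> real) set" and nu mu :: "real \<times> real \<Rightarrow> real"
  assumes D: "open D" and sm_nu: "smooth_on D nu" and sm_mu: "smooth_on D mu"
    and mu_pos: "p \<in> D \<Longrightarrow> 0 < mu p" and nu_nz: "p \<in> D \<Longrightarrow> nu p \<noteq> 0"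
    and ne: "p \<in> D \<Longrightarrow> (mu p)\<^sup>2 \<noteq> (nu p)\<^sup>2"
begin

definition phi :: "real \<times> real \<Rightarrow> real" where "phi q = ln \<bar>(mu q)\<^sup>2 - (nu q)\<^sup>2\<bar>"
definition theta :: "real \<times> real \<Rightarrow> real" where "theta q = 1/2 * ln \<bar>(mu q + nu q) / (mu q - nu q)\<bar>"
definition lam :: "real \<times> real \<Rightarrow> real" where "lam q = exp (- phi q / 4)"

text \<open>The coefficients in one direction use derivatives in the other: (g, t) is (phi_v / 4,
  theta_v) for u and (phi_u / 4, theta_u) for v.\<close>

definition Cm :: "bool \<Rightarrow> real \<times> real \<Rightarrow> real^4^4" where
  "Cm b p = conn b (pd (\<not> b) phi p / 4) (pd (\<not> b) theta p) (lam p * nu p) (lam p * mu p)"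

lemma sub: "D' \<subseteq> D \<Longrightarrow> open D' \<Longrightarrow> invariant_pair D' nu mu"
  using sm_nu sm_mu mu_pos nu_nz ne by unfold_locales (auto intro: smooth_on_subset)

lemma mu_pd: "p \<in> D \<Longrightarrow> has_pd b mu (pd b mu p) p" and nu_pd: "p \<in> D \<Longrightarrow> has_pd b nu (pd b nu p) p"
  using smooth_on_has_pd sm_mu sm_nu by blast+

lemma s_nz: "p \<in> D \<Longrightarrow> (mu p)\<^sup>2 - (nu p)\<^sup>2 \<noteq> 0"
  using ne by simp

lemma sum_diff_nz: "p \<in> D \<Longrightarrow> mu p + nu p \<noteq> 0" "p \<in> D \<Longrightarrow> mu p - nu p \<noteq> 0"
  using ne[of p] by (auto simp: power2_eq_iff)

lemma s_pd: "p \<in> D \<Longrightarrow> has_pd b (\<lambda>q. (mu q)\<^sup>2 - (nu q)\<^sup>2) (2 * (mu p * pd b mu p - nu p * pd b nu p)) p"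
proof -
  assume p: "p \<in> D"
  have "has_pd b (\<lambda>q. mu q * mu q + - (nu q * nu q))
     ((mu p * pd b mu p + pd b mu p * mu p) + - (nu p * pd b nu p + pd b nu p * nu p)) p"
    by (intro has_pd_add has_pd_minus has_pd_bilinear[OF bounded_bilinear_mult] mu_pd nu_pd p)
  then show ?thesis
    by (simp add: power2_eq_square algebra_simps)
qed

lemma phi_has_pd: "p \<in> D \<Longrightarrow>
    has_pd b phi (2 * (mu p * pd b mu p - nu p * pd b nu p) / ((mu p)\<^sup>2 - (nu p)\<^sup>2)) p"
  using has_pd_chain[OF s_pd has_real_derivative_ln_abs[OF s_nz]] unfolding phi_def[abs_def] by simp

lemma theta_has_pd: "p \<in> D \<Longrightarrow>
    has_pd b theta ((mu p * pd b nu p - nu p * pd b mu p) / ((mu p)\<^sup>2 - (nu p)\<^sup>2)) p"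
proof -
  assume p: "p \<in> D"
  \<comment> \<open>Differences appear as sums with a negated term to fit \<open>has_pd_add\<close>
    and \<open>has_pd_minus\<close>. The split of the logarithm is valid on D, hence the transfer by
    \<open>has_pd_cong\<close>.\<close>
  have 1: "has_pd b (\<lambda>q. 1/2 * (ln \<bar>mu q + nu q\<bar> + - ln \<bar>mu q + - nu q\<bar>))
     (1/2 * (1 / (mu p + nu p) * (pd b mu p + pd b nu p) + - (1 / (mu p + - nu p) * (pd b mu p + - pd b nu p)))) p"
    using sum_diff_nz[OF p]
    by (intro has_pd_linear[OF bounded_linear_mult_right] has_pd_add has_pd_minus
        has_pd_chain[OF _ has_real_derivative_ln_abs] mu_pd nu_pd p) auto
  have 2: "1/2 * (ln \<bar>mu q + nu q\<bar> + - ln \<bar>mu q + - nu q\<bar>) = theta q" if "q \<in> D" for q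
    using sum_diff_nz[OF that] by (simp add: theta_def abs_divide ln_div)
  have 3: "1/2 * (1 / (mu p + nu p) * (pd b mu p + pd b nu p) + - (1 / (mu p + - nu p) * (pd b mu p + - pd b nu p)))
     = (mu p * pd b nu p - nu p * pd b mu p) / ((mu p)\<^sup>2 - (nu p)\<^sup>2)"
  proof -
    have eq: "(mu p)\<^sup>2 - (nu p)\<^sup>2 = (mu p + nu p) * (mu p - nu p)"
      by (simp add: power2_eq_square algebra_simps)
    show ?thesis
      unfolding eq using sum_diff_nz[OF p] by (simp add: divide_simps) algebra
  qed
  show ?thesis
    using has_pd_cong[OF D p 2 1] unfolding 3 .
qed

lemma smooth_s: "smooth_on D (\<lambda>q. (mu q)\<^sup>2 - (nu q)\<^sup>2)"
  unfolding power2_eq_square by (intro smooth_on_diff smooth_on_mult D sm_mu sm_nu)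

lemma smooth_phi: "smooth_on D phi"
proof (rule smooth_on_if_pd_smooth[OF D _ phi_has_pd])
  show "continuous_on D phi"
    unfolding phi_def using smooth_on_continuous[OF smooth_s] s_nz
    by (intro continuous_on_ln continuous_on_rabs) auto
  show "smooth_on D (\<lambda>p. 2 * (mu p * pd b mu p - nu p * pd b nu p) / ((mu p)\<^sup>2 - (nu p)\<^sup>2))" for b
    by (intro smooth_on_divide smooth_on_mult smooth_on_const smooth_on_diff smooth_s smooth_on_pd sm_mu sm_nu D s_nz)
qed

lemma smooth_theta: "smooth_on D theta"
proof (rule smooth_on_if_pd_smooth[OF D _ theta_has_pd])
  have "continuous_on D (\<lambda>q. ln \<bar>(mu q + nu q) / (mu q - nu q)\<bar>)"
    using smooth_on_continuous[OF sm_mu] smooth_on_continuous[OF sm_nu] sum_diff_nz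
    by (intro continuous_on_ln continuous_on_rabs continuous_on_divide continuous_intros) auto
  then show "continuous_on D theta"
    unfolding theta_def[abs_def] by (rule continuous_on_mult_left)
  show "smooth_on D (\<lambda>p. (mu p * pd b nu p - nu p * pd b mu p) / ((mu p)\<^sup>2 - (nu p)\<^sup>2))" for b
    by (intro smooth_on_divide smooth_on_mult smooth_on_diff smooth_s smooth_on_pd sm_mu sm_nu D s_nz)
qed

lemma phi_pd: "p \<in> D \<Longrightarrow> has_pd b phi (pd b phi p) p" and theta_pd: "p \<in> D \<Longrightarrow> has_pd b theta (pd b theta p) p"
  using smooth_on_has_pd smooth_phi smooth_theta by blast+

lemma phi_pd_eq: "p \<in> D \<Longrightarrow> pd b phi p * ((mu p)\<^sup>2 - (nu p)\<^sup>2) = 2 * (mu p * pd b mu p - nu p * pd b nu p)"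
  using has_pd_imp_pd[OF phi_has_pd] s_nz by simp

lemma theta_pd_eq: "p \<in> D \<Longrightarrow> pd b theta p * ((mu p)\<^sup>2 - (nu p)\<^sup>2) = mu p * pd b nu p - nu p * pd b mu p"
  using has_pd_imp_pd[OF theta_has_pd] s_nz by simp

text \<open>Clearing the denominator mu^2 - nu^2 leaves polynomial consequences of
  \<open>phi_pd_eq\<close> and \<open>theta_pd_eq\<close>. In the second derivatives of the frame
  the factor 1/2 arises as one quarter from \<open>lam\<close> and one quarter from a gamma.\<close>

lemma nu_codazzi: "p \<in> D \<Longrightarrow> pd b nu p - pd b phi p / 2 * nu p = mu p * pd b theta p"
  and mu_codazzi: "p \<in> D \<Longrightarrow> pd b mu p - pd b phi p / 2 * mu p = nu p * pd b theta p"
proof -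
  assume p: "p \<in> D"
  have "(pd b nu p - pd b phi p / 2 * nu p) * ((mu p)\<^sup>2 - (nu p)\<^sup>2) = (mu p * pd b theta p) * ((mu p)\<^sup>2 - (nu p)\<^sup>2)"
    using phi_pd_eq[OF p, of b] theta_pd_eq[OF p, of b] by algebra
  then show "pd b nu p - pd b phi p / 2 * nu p = mu p * pd b theta p"
    using s_nz[OF p] by simp
  have "(pd b mu p - pd b phi p / 2 * mu p) * ((mu p)\<^sup>2 - (nu p)\<^sup>2) = (nu p * pd b theta p) * ((mu p)\<^sup>2 - (nu p)\<^sup>2)"
    using phi_pd_eq[OF p, of b] theta_pd_eq[OF p, of b] by algebra
  then show "pd b mu p - pd b phi p / 2 * mu p = nu p * pd b theta p"
    using s_nz[OF p] by simp
qed

lemma lam_pos: "0 < lam p"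
  by (simp add: lam_def)

lemma lam_pd: "p \<in> D \<Longrightarrow> has_pd b lam (- (pd b phi p / 4) * lam p) p"
proof -
  assume p: "p \<in> D"
  have "((\<lambda>x. exp (- x / 4)) has_real_derivative exp (- phi p / 4) * (- (1/4))) (at (phi p))"
    by (auto intro!: derivative_eq_intros)
  from has_pd_chain[OF phi_pd[OF p] this] show ?thesis
    unfolding lam_def[abs_def] by (simp add: algebra_simps)
qed

text \<open>\<open>lam\<close> solves lam_b = -(phi_b / 4) lam, so the bootstrap for linear systems
  applies with multiplication as bilinear map.\<close>

lemma smooth_lam: "smooth_on D lam"
proof (rule smooth_on_linear_system[OF D bounded_bilinear_mult _ _ lam_pd])
  show "smooth_on D (\<lambda>p. - (pd b phi p / 4))" for b
    using smooth_on_minus[OF D smooth_on_divide[OF D _ smooth_on_pd[OF smooth_phi] smooth_on_const[OF D], of 4]]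
    by simp
  show "continuous_on D lam"
    unfolding lam_def[abs_def] using smooth_on_continuous[OF smooth_phi] by (intro continuous_intros) auto
qed

lemma lam_sq: "p \<in> D \<Longrightarrow> (lam p)\<^sup>2 * sqrt \<bar>(mu p)\<^sup>2 - (nu p)\<^sup>2\<bar> = 1"
proof -
  assume p: "p \<in> D"
  have "sqrt \<bar>(mu p)\<^sup>2 - (nu p)\<^sup>2\<bar> = exp (phi p / 2)"
  proof (rule real_sqrt_unique)
    show "(exp (phi p / 2))\<^sup>2 = \<bar>(mu p)\<^sup>2 - (nu p)\<^sup>2\<bar>"
      using s_nz[OF p] by (simp add: power2_eq_square phi_def flip: exp_add)
  qed simp
  then show ?thesis
    by (simp add: lam_def power2_eq_square flip: exp_add)
qed

lemma lam_nu_pd: "p \<in> D \<Longrightarrow> has_pd b (\<lambda>q. lam q * nu q) (lam p * (pd b nu p - pd b phi p / 4 * nu p)) p"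
  and lam_mu_pd: "p \<in> D \<Longrightarrow> has_pd b (\<lambda>q. lam q * mu q) (lam p * (pd b mu p - pd b phi p / 4 * mu p)) p"
  using has_pd_bilinear[OF bounded_bilinear_mult lam_pd nu_pd] has_pd_bilinear[OF bounded_bilinear_mult lam_pd mu_pd]
  by (simp_all add: algebra_simps)

lemma smooth_Cm: "smooth_on D (Cm b)"
  unfolding Cm_def[abs_def]
  by (intro smooth_on_conn smooth_on_divide smooth_on_const smooth_on_mult smooth_on_pd smooth_phi
      smooth_theta smooth_lam sm_nu sm_mu D) auto

lemma transpose_Cm: "transpose (Cm b p) = - Cm b p"
  by (simp add: Cm_def transpose_conn)

end

section \<open>Recognising a canonical surface\<close>

lemma pd_simps [simp]: "pd True f = pu f" "pd False f = pv f"
  by (simp_all add: pd_def)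

lemma matrix_mult_transpose_nth: "(W ** transpose W) $ i $ j = W $ i \<bullet> (W $ j :: real^'n)"
  by (simp add: matrix_matrix_mult_def transpose_def inner_vec_def)

context
  fixes z :: surf and x y n1 n2 :: "real^4" and p :: "real \<times> real"
    and l nu mu c1 c2 c3 c4 c5 c6 :: real
  assumes orth: "x \<bullet> x = 1" "y \<bullet> y = 1" "n1 \<bullet> n1 = 1" "n2 \<bullet> n2 = 1"
      "x \<bullet> y = 0" "x \<bullet> n1 = 0" "x \<bullet> n2 = 0" "y \<bullet> n1 = 0" "y \<bullet> n2 = 0" "n1 \<bullet> n2 = 0"
    and l: "0 < l"
    and z1: "pu z p = l *\<^sub>R x" "pv z p = l *\<^sub>R y"
    and z2: "pu (pu z) p = c1 *\<^sub>R x + c2 *\<^sub>R y + (l\<^sup>2 * nu) *\<^sub>R n1"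
      "pv (pu z) p = c3 *\<^sub>R x + c4 *\<^sub>R y + (l\<^sup>2 * mu) *\<^sub>R n2"
      "pv (pv z) p = c5 *\<^sub>R x + c6 *\<^sub>R y - (l\<^sup>2 * nu) *\<^sub>R n1"
begin

lemma first_form: "fE z p = l\<^sup>2" "fF z p = 0" "fG z p = l\<^sup>2"
  using orth by (simp_all add: fE_def fF_def fG_def z1 power2_eq_square)

text \<open>\<open>nproj\<close> annihilates the tangential parts with coefficients
  \<open>c1\<close> to \<open>c6\<close>, which may therefore stay arbitrary.\<close>

lemma sff2_eq: "sff2 z n1 n2 p a b c d =
    ((a * c - b * d) * l\<^sup>2 * nu) *\<^sub>R n1 + ((a * d + b * c) * l\<^sup>2 * mu) *\<^sub>R n2"
  using orth by (simp add: sff2_def nproj_def z2 inner_commute algebra_simps)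

lemma sff_eq: "sff z n1 n2 p a b =
    ((a\<^sup>2 - b\<^sup>2) * l\<^sup>2 * nu) *\<^sub>R n1 + (2 * a * b * l\<^sup>2 * mu) *\<^sub>R n2"
  using orth by (simp add: sff_def nproj_def z2 inner_commute algebra_simps)

lemma mean_curv_eq: "mean_curv z n1 n2 p = 0"
  using orth by (simp add: mean_curv_def first_form nproj_def z2 inner_commute algebra_simps)

lemma unit_tan_iff: "unit_tan z p a b \<longleftrightarrow> l\<^sup>2 * (a\<^sup>2 + b\<^sup>2) = 1"
proof -
  have "tvec z p a b \<bullet> tvec z p a b = l\<^sup>2 * (a\<^sup>2 + b\<^sup>2)"
    using orth by (simp add: tvec_def z1 inner_commute algebra_simps power2_eq_square)
  then show ?thesis
    by (simp add: unit_tan_def norm_eq_1)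
qed

lemma regular_pointwise: "a *\<^sub>R pu z p + b *\<^sub>R pv z p = 0 \<Longrightarrow> a = 0 \<and> b = 0"
proof -
  assume *: "a *\<^sub>R pu z p + b *\<^sub>R pv z p = 0"
  have "(a *\<^sub>R pu z p + b *\<^sub>R pv z p) \<bullet> x = a * l" "(a *\<^sub>R pu z p + b *\<^sub>R pv z p) \<bullet> y = b * l"
    using orth by (simp_all add: z1 inner_commute algebra_simps)
  then show ?thesis
    using l unfolding * by simp
qed

lemma minimal_pointwise: "minimal_at z n1 n2 p"
  unfolding minimal_at_def
proof (intro allI impI)
  fix a b c d
  assume *: "unit_tan z p a b \<and> unit_tan z p c d \<and> tvec z p a b \<bullet> tvec z p c d = 0"
  have "l\<^sup>2 * (a * c + b * d) = 0"
    using * orth by (simp add: tvec_def z1 inner_commute algebra_simps power2_eq_square)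
  then have ac: "a * c + b * d = 0"
    using l by simp
  have "l\<^sup>2 * (a\<^sup>2 + b\<^sup>2) = l\<^sup>2 * (c\<^sup>2 + d\<^sup>2)"
    using * by (simp add: unit_tan_iff)
  then have eq: "a\<^sup>2 + b\<^sup>2 = c\<^sup>2 + d\<^sup>2"
    using l by simp
  have pos: "a\<^sup>2 + b\<^sup>2 \<noteq> 0"
    using * l by (auto simp: unit_tan_iff)
  \<comment> \<open>Orthogonality and equal length mean (c, d) = \<plusminus>(-b, a). The factor a^2
    + b^2 turns the consequences into polynomial identities without a choice of sign.\<close>
  have "(a\<^sup>2 + b\<^sup>2) * (a\<^sup>2 - b\<^sup>2 + (c\<^sup>2 - d\<^sup>2)) = 0" "(a\<^sup>2 + b\<^sup>2) * (a * b + c * d) = 0"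
    using ac eq by algebra+
  then have "a\<^sup>2 - b\<^sup>2 + (c\<^sup>2 - d\<^sup>2) = 0" "a * b + c * d = 0"
    unfolding mult_eq_0_iff using pos by blast+
  moreover have "sff z n1 n2 p a b + sff z n1 n2 p c d =
      ((a\<^sup>2 - b\<^sup>2 + (c\<^sup>2 - d\<^sup>2)) * l\<^sup>2 * nu) *\<^sub>R n1 + (2 * (a * b + c * d) * l\<^sup>2 * mu) *\<^sub>R n2"
    by (simp add: sff_eq algebra_simps)
  ultimately show "sff z n1 n2 p a b + sff z n1 n2 p c d = 0"
    by simp
qed

text \<open>On the unit circle \<open>|\<sigma>|\<^sup>2 = \<nu>\<^sup>2 + 4 a\<^sup>2 b\<^sup>2 \<lambda>\<^sup>4 (\<mu>\<^sup>2 - \<nu>\<^sup>2)\<close>, which is extremal at \<open>a b = 0\<close>.\<close>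

lemma canonical_pointwise:
  assumes u: "unit_tan z p a b" and ab: "a * b = 0"
  shows "canonical_dir z n1 n2 p a b"
proof -
  have sq: "sff z n1 n2 p c d \<bullet> sff z n1 n2 p c d = nu\<^sup>2 + 4 * (c * d)\<^sup>2 * l^4 * (mu\<^sup>2 - nu\<^sup>2)"
    if "unit_tan z p c d" for c d
  proof -
    have "sff z n1 n2 p c d \<bullet> sff z n1 n2 p c d = ((c\<^sup>2 - d\<^sup>2) * l\<^sup>2 * nu)\<^sup>2 + (2 * c * d * l\<^sup>2 * mu)\<^sup>2"
      using orth by (simp add: sff_eq inner_add_left inner_add_right inner_commute power2_eq_square)
    also have "\<dots> = (l\<^sup>2 * (c\<^sup>2 + d\<^sup>2))\<^sup>2 * nu\<^sup>2 + 4 * (c * d)\<^sup>2 * l^4 * (mu\<^sup>2 - nu\<^sup>2)"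
      by algebra
    finally show ?thesis
      using that by (simp add: unit_tan_iff)
  qed
  have "norm (sff z n1 n2 p c d) \<le> norm (sff z n1 n2 p a b)" if "mu\<^sup>2 \<le> nu\<^sup>2" "unit_tan z p c d" for c d
    using that u ab by (auto simp: norm_le sq zero_le_mult_iff mult_le_0_iff)
  moreover have "norm (sff z n1 n2 p a b) \<le> norm (sff z n1 n2 p c d)" if "nu\<^sup>2 \<le> mu\<^sup>2" "unit_tan z p c d" for c d
    using that u ab by (auto simp: norm_le sq zero_le_mult_iff mult_le_0_iff)
  ultimately show ?thesis
    using u linear[of "mu\<^sup>2" "nu\<^sup>2"] by (auto simp: canonical_dir_def curv_ellipse_def mean_curv_eq)
qed

lemma canonical_axes: "canonical_dir z n1 n2 p (1 / sqrt (fE z p)) 0" "canonical_dir z n1 n2 p 0 (1 / sqrt (fG z p))"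
  using l by (auto intro!: canonical_pointwise simp: unit_tan_iff first_form power_divide)

lemma gauss_curv_eq: "gauss_curv z n1 n2 p = - (nu\<^sup>2 + mu\<^sup>2)"
proof -
  have "gauss_curv z n1 n2 p = - ((l\<^sup>2 * nu)\<^sup>2 + (l\<^sup>2 * mu)\<^sup>2) / (l\<^sup>2 * l\<^sup>2)"
    using orth by (simp add: gauss_curv_def sff2_eq first_form inner_commute power2_eq_square)
  also have "\<dots> = - (nu\<^sup>2 + mu\<^sup>2)"
    using l by (simp add: power2_eq_square field_simps)
  finally show ?thesis .
qed

end

text \<open>\<open>grad\<close> makes gamma_1 gamma_2 nonzero and \<open>ricci\<close> evaluates the
  normal curvature; the other properties are read off from the rows of \<open>W\<close>, which are
  x, y, n1, n2.\<close>

lemma (in invariant_pair) canonical_surfaceI: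
  assumes z: "\<And>b p. p \<in> D \<Longrightarrow> has_pd b z (tang b (lam p) v* W p) p"
    and W: "\<And>b p. p \<in> D \<Longrightarrow> has_pd b W (Cm b p ** W p) p"
    and cont: "continuous_on D z" "continuous_on D W"
    and orth: "\<And>p. p \<in> D \<Longrightarrow> W p ** transpose (W p) = mat 1" and det: "\<And>p. p \<in> D \<Longrightarrow> 0 < det (W p)"
    and grad: "\<And>b p. p \<in> D \<Longrightarrow> pd b phi p \<noteq> 0"
    and ricci: "\<And>p. p \<in> D \<Longrightarrow> laplacian theta p = - 2 * (lam p)\<^sup>2 * nu p * mu p"
  shows "canonical_surface_with_invariants D z nu mu"
proof -
  define n1 n2 where "n1 p = W p $ 3" and "n2 p = W p $ 4" for p
  define g1 where "g1 p = pv phi p / 4 / lam p" for p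
  define g2 where "g2 p = pu phi p / 4 / lam p" for p
  define b1 where "b1 p = - pv theta p / lam p" for p
  define b2 where "b2 p = pu theta p / lam p" for p
  have smW: "smooth_on D W"
    by (rule smooth_on_linear_system[OF D bounded_bilinear_matrix_mult smooth_Cm cont(2) W])
  have smz: "smooth_on D z"
    by (rule smooth_on_if_pd_smooth[OF D cont(1) z], assumption)
      (intro smooth_on_bilinear[OF D bounded_bilinear_vector_matrix_mult] smooth_on_tang D smooth_lam smW)
  have smn: "smooth_on D n1" "smooth_on D n2"
    unfolding n1_def[abs_def] n2_def[abs_def] by (intro smooth_on_linear[OF D bounded_linear_vec_nth] smW)+
  have row: "has_pd b (\<lambda>q. W q $ i) ((Cm b p ** W p) $ i) p" if "p \<in> D" for b i p
    by (rule has_pd_linear[OF bounded_linear_vec_nth W[OF that]])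
  have zu: "pu z p = lam p *\<^sub>R W p $ 1" and zv: "pv z p = lam p *\<^sub>R W p $ 2" if "p \<in> D" for p
    using has_pd_imp_pd[OF z[OF that, of True]] has_pd_imp_pd[OF z[OF that, of False]] by (simp_all add: tang_mult)
  have lrow: "has_pd b (\<lambda>q. lam q *\<^sub>R W q $ i)
      (lam p *\<^sub>R (Cm b p ** W p) $ i + (- (pd b phi p / 4) * lam p) *\<^sub>R W p $ i) p" if "p \<in> D" for b i p
    using has_pd_bilinear[OF bounded_bilinear_scaleR lam_pd[OF that] row[OF that]] .
  have zub: "pd b (pu z) p = lam p *\<^sub>R (Cm b p ** W p) $ 1 + (- (pd b phi p / 4) * lam p) *\<^sub>R W p $ 1"
    and zvb: "pd b (pv z) p = lam p *\<^sub>R (Cm b p ** W p) $ 2 + (- (pd b phi p / 4) * lam p) *\<^sub>R W p $ 2"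
    if "p \<in> D" for b p
    using has_pd_cong[OF D that _ lrow[OF that], of 1 "pu z"] has_pd_cong[OF D that _ lrow[OF that], of 2 "pv z"]
    by (auto intro!: has_pd_imp_pd simp: zu zv)
  have z2: "pu (pu z) p = (- (pu phi p / 4) * lam p) *\<^sub>R W p $ 1 + (lam p * (pv phi p / 4)) *\<^sub>R W p $ 2
        + ((lam p)\<^sup>2 * nu p) *\<^sub>R W p $ 3"
    "pv (pu z) p = (- (pv phi p / 4) * lam p) *\<^sub>R W p $ 1 + (- lam p * (pu phi p / 4)) *\<^sub>R W p $ 2
        + ((lam p)\<^sup>2 * mu p) *\<^sub>R W p $ 4"
    "pv (pv z) p = (lam p * (pu phi p / 4)) *\<^sub>R W p $ 1 + (- (pv phi p / 4) * lam p) *\<^sub>R W p $ 2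
        - ((lam p)\<^sup>2 * nu p) *\<^sub>R W p $ 3" if "p \<in> D" for p
    using zub[OF that, of True] zub[OF that, of False] zvb[OF that, of False]
    by (simp_all add: Cm_def conn_rows algebra_simps power2_eq_square)
  have ip: "W p $ i \<bullet> W p $ j = (if i = j then 1 else 0)" if "p \<in> D" for p i j
    using orth[OF that] matrix_mult_transpose_nth[of "W p" i j] by (simp add: mat_def)
  have on: "W p $ 1 \<bullet> W p $ 1 = 1" "W p $ 2 \<bullet> W p $ 2 = 1" "W p $ 3 \<bullet> W p $ 3 = 1" "W p $ 4 \<bullet> W p $ 4 = 1"
    "W p $ 1 \<bullet> W p $ 2 = 0" "W p $ 1 \<bullet> W p $ 3 = 0" "W p $ 1 \<bullet> W p $ 4 = 0"
    "W p $ 2 \<bullet> W p $ 3 = 0" "W p $ 2 \<bullet> W p $ 4 = 0" "W p $ 3 \<bullet> W p $ 4 = 0" if "p \<in> D" for p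
    by (simp_all add: ip that)
  \<comment> \<open>The sixteen hypotheses of the pointwise context in order. All except
    \<open>lam_pos\<close> carry the premise p \<in> D, hence the fifteen copies of \<open>p\<close>
    below.\<close>
  note pt = on lam_pos zu zv z2
  have ff: "fE z p = (lam p)\<^sup>2" "fF z p = 0" "fG z p = (lam p)\<^sup>2" if "p \<in> D" for p
    using that ip[OF that] by (simp_all add: fE_def fF_def fG_def zu zv power2_eq_square)
  have sqE: "sqrt (fE z p) = lam p" "sqrt (fG z p) = lam p" if "p \<in> D" for p
    using lam_pos[of p] by (simp_all add: ff[OF that])
  have xf: "xfield z p = W p $ 1" and yf: "yfield z p = W p $ 2" if "p \<in> D" for p
    using lam_pos[of p] by (simp_all add: xfield_def yfield_def sqE zu zv that)
  have dxf: "pd b (xfield z) p = (Cm b p ** W p) $ 1" and dyf: "pd b (yfield z) p = (Cm b p ** W p) $ 2" if "p \<in> D" for b p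
    using has_pd_cong[OF D that _ row[OF that], of 1 "xfield z"] has_pd_cong[OF D that _ row[OF that], of 2 "yfield z"]
    by (auto intro!: has_pd_imp_pd simp: xf yf)
  have dn: "pd b n1 p = (Cm b p ** W p) $ 3" "pd b n2 p = (Cm b p ** W p) $ 4" if "p \<in> D" for b p
    unfolding n1_def[abs_def] n2_def[abs_def] by (intro has_pd_imp_pd row that)+
  \<comment> \<open>n2_v . n1 = -theta_u and n2_u . n1 = theta_v, so the numerator is minus the
    Laplacian of \<open>theta\<close>, and the division by sqrt (E G) = lam^2 removes the factor in
    \<open>ricci\<close>.\<close>
  have nc: "normal_curv z n1 n2 p = 2 * nu p * mu p" if p: "p \<in> D" for p
  proof -
    have 1: "pv n2 q \<bullet> n1 q = - pu theta q" "pu n2 q \<bullet> n1 q = pv theta q" if "q \<in> D" for q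
      using dn(2)[OF that, of True] dn(2)[OF that, of False] ip[OF that]
      by (simp_all add: Cm_def conn_rows n1_def inner_add_left inner_diff_left)
    have "has_pd True (\<lambda>q. - pu theta q) (- pu (pu theta) p) p" "has_pd False (pv theta) (pv (pv theta) p) p"
      using smooth_on_has_pd[OF smooth_on_pd[OF smooth_theta, of True] p, of True]
        smooth_on_has_pd[OF smooth_on_pd[OF smooth_theta, of False] p, of False] by (auto intro: has_pd_minus)
    then have "has_pd True (\<lambda>q. pv n2 q \<bullet> n1 q) (- pu (pu theta) p) p" "has_pd False (\<lambda>q. pu n2 q \<bullet> n1 q) (pv (pv theta) p) p"
      using 1 by (auto intro: has_pd_cong[OF D p])
    from this[THEN has_pd_imp_pd]
    have "pu (\<lambda>q. pv n2 q \<bullet> n1 q) p - pv (\<lambda>q. pu n2 q \<bullet> n1 q) p = - laplacian theta p"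
      by (simp add: laplacian_def)
    then show ?thesis
      using ricci[OF p] lam_pos[of p] by (simp add: normal_curv_def ff p power2_eq_square)
  qed
  have reg: "regular_on D z"
    unfolding regular_on_def using regular_pointwise[OF pt] by blast
  have minimal: "minimal_at z (n1 p) (n2 p) p"
    and gc: "gauss_curv z (n1 p) (n2 p) p = - ((nu p)\<^sup>2 + (mu p)\<^sup>2)"
    and can: "canonical_dir z (n1 p) (n2 p) p (1 / sqrt (fE z p)) 0" "canonical_dir z (n1 p) (n2 p) p 0 (1 / sqrt (fG z p))"
    if p: "p \<in> D" for p
    unfolding n1_def n2_def
    by (fact minimal_pointwise[OF pt, OF p p p p p p p p p p p p p p p] gauss_curv_eq[OF pt, OF p p p p p p p p p p p p p p p]
        canonical_axes[OF pt, OF p p p p p p p p p p p p p p p])+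
  have frame: "geometric_frame_on D z n1 n2 nu mu g1 g2 b1 b2"
    unfolding geometric_frame_on_def Let_def
  proof (intro ballI conjI)
    fix p assume p: "p \<in> D"
    have "vector [xfield z p, yfield z p, n1 p, n2 p] = W p"
      by (simp add: vec_eq_iff forall_4 xf yf p n1_def n2_def)
    then show "pos_oriented (xfield z p) (yfield z p) (n1 p) (n2 p)"
      using det[OF p] by (simp add: pos_oriented_def)
    show "normal_frame_at z (n1 p) (n2 p) p"
      using ip[OF p] by (simp add: normal_frame_at_def n1_def n2_def zu zv p)
    note d = Dx_def Dy_def sqE[OF p] xf[OF p] yf[OF p] dxf[OF p, of True, simplified] dxf[OF p, of False, simplified]
      dyf[OF p, of True, simplified] dyf[OF p, of False, simplified] dn[OF p, of True, simplified] dn[OF p, of False, simplified]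
      n1_def[of p] n2_def[of p] Cm_def conn_rows g1_def g2_def b1_def b2_def
    note l = lam_pos[of p]
    show "Dx z (xfield z) p = g1 p *\<^sub>R yfield z p + nu p *\<^sub>R n1 p"
      "Dx z (yfield z) p = - g1 p *\<^sub>R xfield z p + mu p *\<^sub>R n2 p"
      "Dy z (xfield z) p = - g2 p *\<^sub>R yfield z p + mu p *\<^sub>R n2 p"
      "Dy z (yfield z) p = g2 p *\<^sub>R xfield z p - nu p *\<^sub>R n1 p"
      "Dx z n1 p = - nu p *\<^sub>R xfield z p + b1 p *\<^sub>R n2 p"
      "Dy z n1 p = nu p *\<^sub>R yfield z p + b2 p *\<^sub>R n2 p"
      "Dx z n2 p = - mu p *\<^sub>R yfield z p - b1 p *\<^sub>R n1 p"
      "Dy z n2 p = - mu p *\<^sub>R xfield z p - b2 p *\<^sub>R n1 p"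
      unfolding d using l by (simp_all add: scaleR_add_right scaleR_diff_right)
  qed (use ip xf yf mu_pos nu_nz ne can in auto)
  have "0 < (gauss_curv z (n1 p) (n2 p) p)\<^sup>2 - (normal_curv z n1 n2 p)\<^sup>2" if p: "p \<in> D" for p
  proof -
    have "(gauss_curv z (n1 p) (n2 p) p)\<^sup>2 - (normal_curv z n1 n2 p)\<^sup>2 = ((mu p)\<^sup>2 - (nu p)\<^sup>2)\<^sup>2"
      by (simp add: gc nc p power2_eq_square algebra_simps)
    then show ?thesis
      using s_nz[OF p] by simp
  qed
  moreover have "g1 p * g2 p \<noteq> 0" if "p \<in> D" for p
    using grad[OF that, of True] grad[OF that, of False] lam_pos[of p] by (simp add: g1_def g2_def)
  moreover have "normal_curv z n1 n2 p \<noteq> 0" if "p \<in> D" for p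
    using mu_pos[OF that] nu_nz[OF that] by (simp add: nc that)
  moreover have "fE z p * sqrt \<bar>(mu p)\<^sup>2 - (nu p)\<^sup>2\<bar> = 1" "fG z p * sqrt \<bar>(mu p)\<^sup>2 - (nu p)\<^sup>2\<bar> = 1" if "p \<in> D" for p
    using lam_sq[OF that] by (simp_all only: ff[OF that])
  ultimately show ?thesis
    unfolding canonical_surface_with_invariants_def
    by (intro conjI smz reg exI[of _ n1] exI[of _ n2] exI[of _ g1] exI[of _ g2] exI[of _ b1] exI[of _ b2] ballI
        smn frame minimal ff(2))
qed

section \<open>Existence and uniqueness\<close>

text \<open>Joins W_b = C_b W and z_b = tang_b W into one linear system: the left argument is the
  pair of coefficients, the right one the unknown (W, z).\<close>

definition frame_prod :: "(real^4^4) \<times> (real^4) \<Rightarrow> (real^4^4) \<times> (real^4) \<Rightarrow> (real^4^4) \<times> (real^4)" where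
  "frame_prod A w = (fst A ** fst w, snd A v* fst w)"

lemma bounded_bilinear_frame_prod: "bounded_bilinear frame_prod"
  unfolding bilinear_conv_bounded_bilinear[symmetric] bilinear_def
proof (intro conjI allI linearI)
  note m = bounded_bilinear_matrix_mult and v = bounded_bilinear_vector_matrix_mult
  note r = bounded_bilinear.add_left[OF m] bounded_bilinear.add_right[OF m]
    bounded_bilinear.scaleR_left[OF m] bounded_bilinear.scaleR_right[OF m]
    bounded_bilinear.add_left[OF v] bounded_bilinear.add_right[OF v]
    bounded_bilinear.scaleR_left[OF v] bounded_bilinear.scaleR_right[OF v]
  fix A B w y :: "(real^4^4) \<times> (real^4)" and c :: real
  show "frame_prod A (w + y) = frame_prod A w + frame_prod A y" "frame_prod A (c *\<^sub>R w) = c *\<^sub>R frame_prod A w"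
    "frame_prod (A + B) w = frame_prod A w + frame_prod B w" "frame_prod (c *\<^sub>R A) w = c *\<^sub>R frame_prod A w"
    by (simp_all add: frame_prod_def prod_eq_iff r)
qed

text \<open>This is W_uv = W_vu without the factor W. The derivatives of \<open>lam * nu\<close> and
  \<open>lam * mu\<close> enter in their Codazzi form, which makes the tangent-normal entries agree;
  \<open>gauss\<close> settles the tangent block and \<open>ricci\<close> the normal block.\<close>

lemma conn_flat:
  assumes gauss: "gv + gu = - L\<^sup>2 * (N\<^sup>2 + M\<^sup>2)" and ricci: "tv + tu = - 2 * L\<^sup>2 * N * M"
  shows "conn True gv tv (L * (g1 * N + M * t1)) (L * (g1 * M + N * t1))
        + conn True g1 t1 (L * N) (L * M) ** conn False g2 t2 (L * N) (L * M)
     = conn False gu tu (L * (g2 * N + M * t2)) (L * (g2 * M + N * t2))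
        + conn False g2 t2 (L * N) (L * M) ** conn True g1 t1 (L * N) (L * M)" (is "?l = ?r")
proof -
  have "gv = - gu - L\<^sup>2 * (N\<^sup>2 + M\<^sup>2)" "tv = - tu - 2 * L\<^sup>2 * N * M"
    using gauss ricci by simp_all
  then have "\<forall>i j. ?l $ i $ j = ?r $ i $ j"
    by (simp add: forall_4 conn_def matrix_matrix_mult_def sum_4 power2_eq_square algebra_simps)
  then show ?thesis
    by (simp add: vec_eq_iff)
qed

text \<open>This is z_uv = z_vu, given lam_v = -g1 lam and lam_u = -g2 lam: the tangential parts
  coincide and both normal parts are L m along n2.\<close>

lemma tang_flat:
  "tang True (- g1 * L) + tang True L v* conn False g2 t2 a m = tang False (- g2 * L) + tang False L v* conn True g1 t1 a m"
  by (simp add: vec_eq_iff forall_4 tang_def conn_def vector_matrix_mult_def sum_4)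

context invariant_pair
begin

text \<open>The coefficient matrix is skew, so the two terms of the product rule cancel. With V = W
  this preserves orthogonality; for the frames of two surfaces it yields the motion.\<close>

lemma frames_gram_pd:
  assumes "has_pd b V (Cm b p ** V p) p" "has_pd b W (Cm b p ** W p) p"
  shows "has_pd b (\<lambda>q. transpose (V q) ** W q) 0 p"
proof -
  note m = bounded_bilinear_matrix_mult
  have "transpose (Cm b p ** V p) ** W p = - (transpose (V p) ** (Cm b p ** W p))"
    by (simp add: matrix_transpose_mul transpose_Cm bounded_bilinear.minus_left[OF m]
        bounded_bilinear.minus_right[OF m] matrix_mul_assoc)
  then show ?thesis
    using has_pd_bilinear[OF m has_pd_linear[OF bounded_linear_transpose assms(1)] assms(2)] by simp
qed

lemma exists_surface:
  assumes p0: "p0 \<in> D" and grad: "\<And>b p. p \<in> D \<Longrightarrow> pd b phi p \<noteq> 0"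
    and gauss: "\<And>p. p \<in> D \<Longrightarrow> laplacian phi p = - 4 * (lam p)\<^sup>2 * ((nu p)\<^sup>2 + (mu p)\<^sup>2)"
    and ricci: "\<And>p. p \<in> D \<Longrightarrow> laplacian theta p = - 2 * (lam p)\<^sup>2 * nu p * mu p"
  shows "\<exists>D0 z. is_domain D0 \<and> D0 \<subseteq> D \<and> canonical_surface_with_invariants D0 z nu mu"
proof -
  obtain u0 v0 where uv: "p0 = (u0, v0)"
    by (cases p0)
  \<comment> \<open>\<open>A' b\<close> is the derivative of \<open>A b\<close> in the direction
    other than b, in the explicit form that the continuity and flatness checks use.\<close>
  define A where "A b p = (Cm b p, tang b (lam p))" for b p
  define A' where "A' b p = (conn b (pd (\<not> b) (pd (\<not> b) phi) p / 4) (pd (\<not> b) (pd (\<not> b) theta) p)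
      (lam p * (pd (\<not> b) nu p - pd (\<not> b) phi p / 4 * nu p)) (lam p * (pd (\<not> b) mu p - pd (\<not> b) phi p / 4 * mu p)),
      tang b (- (pd (\<not> b) phi p / 4) * lam p))" for b p
  have cA: "continuous_on D (A b)" for b
    unfolding A_def[abs_def]
    by (intro continuous_on_Pair smooth_on_continuous smooth_Cm smooth_on_tang D smooth_lam)
  have cA': "continuous_on D (A' b)" for b
    unfolding A'_def[abs_def]
    by (intro continuous_on_Pair smooth_on_continuous smooth_on_conn smooth_on_tang smooth_on_divide smooth_on_minus
        smooth_on_mult smooth_on_diff smooth_on_const smooth_on_pd smooth_phi smooth_theta smooth_lam sm_nu sm_mu D) auto
  have dA: "has_pd (\<not> b) (A b) (A' b p) p" if p: "p \<in> D" for b p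
  proof -
    have "has_pd (\<not> b) (\<lambda>q. 1/4 * pd (\<not> b) phi q) (1/4 * pd (\<not> b) (pd (\<not> b) phi) p) p"
      by (intro has_pd_linear[OF bounded_linear_mult_right] smooth_on_has_pd[OF smooth_on_pd[OF smooth_phi] p])
    then have "has_pd (\<not> b) (\<lambda>q. pd (\<not> b) phi q / 4) (pd (\<not> b) (pd (\<not> b) phi) p / 4) p"
      by simp
    then show ?thesis
      unfolding A_def A'_def Cm_def
      by (intro has_pd_Pair has_pd_conn has_pd_tang lam_pd lam_nu_pd lam_mu_pd p
          smooth_on_has_pd[OF smooth_on_pd[OF smooth_theta] p])
  qed
  have flat: "frame_prod (A' True p) w + frame_prod (A True p) (frame_prod (A False p) w)
     = frame_prod (A' False p) w + frame_prod (A False p) (frame_prod (A True p) w)" if p: "p \<in> D" for p w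
  proof -
    \<comment> \<open>Codazzi brings the derivatives of \<open>lam * nu\<close> and
      \<open>lam * mu\<close> into the shape expected by \<open>conn_flat\<close>.\<close>
    have cod: "pd b nu p - pd b phi p / 4 * nu p = pd b phi p / 4 * nu p + mu p * pd b theta p"
      "pd b mu p - pd b phi p / 4 * mu p = pd b phi p / 4 * mu p + nu p * pd b theta p" for b
      using nu_codazzi[OF p, of b] mu_codazzi[OF p, of b] by (simp_all add: algebra_simps)
    have "pv (pv phi) p / 4 + pu (pu phi) p / 4 = - (lam p)\<^sup>2 * ((nu p)\<^sup>2 + (mu p)\<^sup>2)"
      "pv (pv theta) p + pu (pu theta) p = - 2 * (lam p)\<^sup>2 * nu p * mu p"
      using gauss[OF p] ricci[OF p] by (simp_all add: laplacian_def algebra_simps)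
    note c = conn_flat[OF this, of "pv phi p / 4" "pv theta p" "pu phi p / 4" "pu theta p"]
    have f1: "fst (A' True p) + fst (A True p) ** fst (A False p) = fst (A' False p) + fst (A False p) ** fst (A True p)"
      unfolding A_def A'_def Cm_def fst_conv not_True_eq_False not_False_eq_True pd_simps cod[of True, unfolded pd_simps]
        cod[of False, unfolded pd_simps] by (rule c)
    have f2: "snd (A' True p) + snd (A True p) v* fst (A False p) = snd (A' False p) + snd (A False p) v* fst (A True p)"
      using tang_flat[of "pv phi p / 4" "lam p" "pu phi p / 4"] by (simp add: A_def A'_def Cm_def)
    have "(fst (A' True p) + fst (A True p) ** fst (A False p)) ** fst w
        = (fst (A' False p) + fst (A False p) ** fst (A True p)) ** fst w"
      "(snd (A' True p) + snd (A True p) v* fst (A False p)) v* fst w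
        = (snd (A' False p) + snd (A False p) v* fst (A True p)) v* fst w"
      by (simp_all only: f1 f2)
    then show ?thesis
      by (simp add: frame_prod_def bounded_bilinear.add_left[OF bounded_bilinear_matrix_mult]
          bounded_bilinear.add_left[OF bounded_bilinear_vector_matrix_mult] matrix_mul_assoc vector_matrix_mul_assoc)
  qed
  obtain d X where d: "0 < d" "{u0..u0+d} \<times> {v0..v0+d} \<subseteq> D" and cX: "continuous_on UNIV X" and X0: "X (u0, v0) = (mat 1, 0)"
    and X: "\<And>p. p \<in> {u0<..<u0+d} \<times> {v0<..<v0+d} \<Longrightarrow> has_pd True X (frame_prod (A True p) (X p)) p"
      "\<And>p. p \<in> {u0<..<u0+d} \<times> {v0<..<v0+d} \<Longrightarrow> has_pd False X (frame_prod (A False p) (X p)) p"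
    using flat_linear_system_solvable[OF bounded_bilinear_frame_prod D, of u0 v0 "A True" "A False" "A' True" "A' False" "(mat 1, 0)"]
      p0 cA cA' dA[of _ True] dA[of _ False] flat by (auto simp: uv)
  define D0 where "D0 = {u0<..<u0+d} \<times> {v0<..<v0+d}"
  have D0: "open D0" "connected D0" "D0 \<noteq> {}" "D0 \<subseteq> D"
    using d by (auto simp: D0_def open_Times intro!: connected_Times)
  \<comment> \<open>\<open>phi\<close>, \<open>theta\<close> and \<open>lam\<close> are built from
    nu and mu alone, so facts about them on D apply directly to this instance.\<close>
  interpret D0: invariant_pair D0 nu mu
    by (rule sub[OF D0(4,1)])
  have Xb: "has_pd b X (frame_prod (A b p) (X p)) p" if "p \<in> D0" for b p
    using X that by (cases b) (auto simp: D0_def)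
  define W z where "W p = fst (X p)" and "z p = snd (X p)" for p
  have W: "has_pd b W (Cm b p ** W p) p" and z: "has_pd b z (tang b (lam p) v* W p) p" if "p \<in> D0" for b p
    using has_pd_linear[OF bounded_linear_fst Xb[OF that]] has_pd_linear[OF bounded_linear_snd Xb[OF that]]
    unfolding W_def[abs_def] z_def[abs_def] by (simp_all add: frame_prod_def A_def)
  have cW: "continuous_on S W" and cz: "continuous_on S z" for S
    unfolding W_def[abs_def] z_def[abs_def]
    by (auto intro!: continuous_on_fst continuous_on_snd continuous_on_subset[OF cX])
  have corner: "(u0, v0) \<in> closure D0"
    using d by (simp add: D0_def closure_Times)
  have W0: "W (u0, v0) = mat 1"
    by (simp add: W_def X0)
  define T where "T p = transpose (W p) ** W p" for p
  have cT: "continuous_on S T" for S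
    unfolding T_def
    by (intro bounded_bilinear.continuous_on[OF bounded_bilinear_matrix_mult]
        bounded_linear.continuous_on[OF bounded_linear_transpose] cW)
  have T_const: "T p = T q" if "p \<in> D0" "q \<in> D0" for p q
    using zero_pd_imp_constant[OF D0(1,2) _ that] frames_gram_pd[OF W W] unfolding T_def[abs_def] by blast
  \<comment> \<open>The value at the corner is known, but the corner is outside \<open>D0\<close>;
    constancy reaches it because \<open>T\<close> is continuous on the closure.\<close>
  have T1: "T p = mat 1" if "p \<in> closure D0" for p
  proof -
    obtain q where q: "q \<in> D0"
      using D0(3) by blast
    have "T r = T q" if "r \<in> closure D0" for r
      using continuous_constant_on_closure[OF cT T_const[OF _ q] that] by blast
    from this[OF that] this[OF corner] show ?thesis
      by (simp add: T_def W0 transpose_mat)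
  qed
  \<comment> \<open>On the connected closure det W equals 1 at the corner and cannot vanish as W^T W
    = 1, so the intermediate value theorem excludes a nonpositive value.\<close>
  have "0 < det (W p)" if p: "p \<in> D0" for p
  proof (rule ccontr)
    assume "\<not> 0 < det (W p)"
    moreover have "connected ((\<lambda>p. det (W p)) ` closure D0)"
      using D0(2) by (intro connected_continuous_image continuous_on_compose2[OF continuous_on_det cW])
        (auto intro: connected_imp_connected_closure)
    moreover have "det (W p) \<in> (\<lambda>p. det (W p)) ` closure D0" "1 \<in> (\<lambda>p. det (W p)) ` closure D0"
      using p corner closure_subset W0 by (force intro: rev_image_eqI)+
    ultimately have "0 \<in> (\<lambda>p. det (W p)) ` closure D0"
      using connectedD_interval[of "(\<lambda>p. det (W p)) ` closure D0" "det (W p)" 1 0] by auto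
    then obtain q where q: "q \<in> closure D0" "det (W q) = 0"
      by auto
    have "det (T q) = 0"
      by (simp add: T_def det_mul q(2))
    then show False
      by (simp add: T1[OF q(1)])
  qed
  moreover have "W p ** transpose (W p) = mat 1" if "p \<in> D0" for p
    using T1[of p] that closure_subset[of D0] by (auto simp: T_def matrix_left_right_inverse)
  ultimately have "canonical_surface_with_invariants D0 z nu mu"
    using W z cW cz grad ricci D0(4) by (intro D0.canonical_surfaceI[of z W]) auto
  then show ?thesis
    using D0 by (auto simp: is_domain_def)
qed

text \<open>Equality of mixed partials identifies the existentially given coefficients with the
  entries of \<open>Cm\<close>: z determines the gammas, x and y the betas.\<close>

lemma surface_frame:
  assumes "canonical_surface_with_invariants D z nu mu"
  obtains W where "\<And>b p. p \<in> D \<Longrightarrow> has_pd b z (tang b (lam p) v* W p) p"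
    "\<And>b p. p \<in> D \<Longrightarrow> has_pd b W (Cm b p ** W p) p"
    "\<And>p. p \<in> D \<Longrightarrow> W p ** transpose (W p) = mat 1" "\<And>p. p \<in> D \<Longrightarrow> 0 < det (W p)"
proof -
  obtain n1 n2 g1 g2 b1 b2 where smz: "smooth_on D z" and smn: "smooth_on D n1" "smooth_on D n2"
    and frame: "geometric_frame_on D z n1 n2 nu mu g1 g2 b1 b2"
    and EG: "\<And>p. p \<in> D \<Longrightarrow> fE z p * sqrt \<bar>(mu p)\<^sup>2 - (nu p)\<^sup>2\<bar> = 1"
      "\<And>p. p \<in> D \<Longrightarrow> fG z p * sqrt \<bar>(mu p)\<^sup>2 - (nu p)\<^sup>2\<bar> = 1"
    using assms unfolding canonical_surface_with_invariants_def by blast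
  define x y where "x = xfield z" and "y = yfield z"
  have sqE: "sqrt (fE z p) = lam p" "sqrt (fG z p) = lam p" if "p \<in> D" for p
  proof -
    have "sqrt \<bar>(mu p)\<^sup>2 - (nu p)\<^sup>2\<bar> \<noteq> 0"
      using s_nz[OF that] by simp
    then have "fE z p = (lam p)\<^sup>2" "fG z p = (lam p)\<^sup>2"
      using EG[OF that] lam_sq[OF that] by (metis mult_right_cancel)+
    then show "sqrt (fE z p) = lam p" "sqrt (fG z p) = lam p"
      using lam_pos[of p] by simp_all
  qed
  have zu: "pu z p = lam p *\<^sub>R x p" and zv: "pv z p = lam p *\<^sub>R y p" if "p \<in> D" for p
    using lam_pos[of p] by (simp_all add: x_def y_def xfield_def yfield_def sqE that)
  have "smooth_on D (\<lambda>q. (1 / lam q) *\<^sub>R pd b z q)" for b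
    using lam_pos[THEN less_imp_neq]
    by (intro smooth_on_scaleR smooth_on_divide smooth_on_const smooth_on_pd smz smooth_lam D) auto
  note lz = this[of True, unfolded pd_simps] this[of False, unfolded pd_simps]
  have lxy: "(1 / lam q) *\<^sub>R pu z q = x q" "(1 / lam q) *\<^sub>R pv z q = y q" if "q \<in> D" for q
    using lam_pos[of q] by (simp_all add: zu zv that)
  have smx: "smooth_on D x" "smooth_on D y"
    using smooth_on_cong[OF D lxy(1) lz(1)] smooth_on_cong[OF D lxy(2) lz(2)] by simp_all
  have orth: "x p \<bullet> x p = 1" "y p \<bullet> y p = 1" "x p \<bullet> y p = 0" "n1 p \<bullet> n1 p = 1" "n2 p \<bullet> n2 p = 1" "n1 p \<bullet> n2 p = 0"
    "n1 p \<bullet> x p = 0" "n1 p \<bullet> y p = 0" "n2 p \<bullet> x p = 0" "n2 p \<bullet> y p = 0"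
    and por: "pos_oriented (x p) (y p) (n1 p) (n2 p)" if "p \<in> D" for p
    using frame lam_pos[of p] that
    by (auto simp: geometric_frame_on_def Let_def normal_frame_at_def zu zv x_def y_def)
  have "y p \<bullet> x p = 0" "n2 p \<bullet> n1 p = 0" "x p \<bullet> n1 p = 0" "y p \<bullet> n1 p = 0" "x p \<bullet> n2 p = 0" "y p \<bullet> n2 p = 0"
    if "p \<in> D" for p
    using orth[OF that] by (simp_all add: inner_commute)
  note orth' = orth this
  have eqs: "pu x p = lam p *\<^sub>R (g1 p *\<^sub>R y p + nu p *\<^sub>R n1 p)"
    "pu y p = lam p *\<^sub>R (- g1 p *\<^sub>R x p + mu p *\<^sub>R n2 p)"
    "pv x p = lam p *\<^sub>R (- g2 p *\<^sub>R y p + mu p *\<^sub>R n2 p)"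
    "pv y p = lam p *\<^sub>R (g2 p *\<^sub>R x p - nu p *\<^sub>R n1 p)"
    "pu n1 p = lam p *\<^sub>R (- nu p *\<^sub>R x p + b1 p *\<^sub>R n2 p)"
    "pv n1 p = lam p *\<^sub>R (nu p *\<^sub>R y p + b2 p *\<^sub>R n2 p)"
    "pu n2 p = lam p *\<^sub>R (- mu p *\<^sub>R y p - b1 p *\<^sub>R n1 p)"
    "pv n2 p = lam p *\<^sub>R (- mu p *\<^sub>R x p - b2 p *\<^sub>R n1 p)" if p: "p \<in> D" for p
  proof -
    have D: "pu f p = lam p *\<^sub>R Dx z f p" "pv f p = lam p *\<^sub>R Dy z f p" for f :: surf
      using lam_pos[of p] by (simp_all add: Dx_def Dy_def sqE[OF p])
    show "pu x p = lam p *\<^sub>R (g1 p *\<^sub>R y p + nu p *\<^sub>R n1 p)"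
      "pu y p = lam p *\<^sub>R (- g1 p *\<^sub>R x p + mu p *\<^sub>R n2 p)"
      "pv x p = lam p *\<^sub>R (- g2 p *\<^sub>R y p + mu p *\<^sub>R n2 p)"
      "pv y p = lam p *\<^sub>R (g2 p *\<^sub>R x p - nu p *\<^sub>R n1 p)"
      "pu n1 p = lam p *\<^sub>R (- nu p *\<^sub>R x p + b1 p *\<^sub>R n2 p)"
      "pv n1 p = lam p *\<^sub>R (nu p *\<^sub>R y p + b2 p *\<^sub>R n2 p)"
      "pu n2 p = lam p *\<^sub>R (- mu p *\<^sub>R y p - b1 p *\<^sub>R n1 p)"
      "pv n2 p = lam p *\<^sub>R (- mu p *\<^sub>R x p - b2 p *\<^sub>R n1 p)"
      using frame p unfolding D x_def y_def geometric_frame_on_def Let_def by auto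
  qed
  have hx: "has_pd b x (pd b x p) p" "has_pd b y (pd b y p) p" "has_pd b n1 (pd b n1 p) p" "has_pd b n2 (pd b n2 p) p"
    if "p \<in> D" for b p
    using smooth_on_has_pd smx smn that by blast+
  \<comment> \<open>The two expressions for the mixed derivative of z are compared along x and along
    y.\<close>
  have g: "lam p * g1 p = pv phi p / 4" "lam p * g2 p = pu phi p / 4" if p: "p \<in> D" for p
  proof -
    have "has_pd False (pu z) (lam p *\<^sub>R pv x p + (- (pv phi p / 4) * lam p) *\<^sub>R x p) p"
      using has_pd_cong[OF D p _ has_pd_bilinear[OF bounded_bilinear_scaleR lam_pd[OF p] hx(1)[OF p]], of "pu z" False]
      by (simp add: zu)
    moreover have "has_pd True (pv z) (lam p *\<^sub>R pu y p + (- (pu phi p / 4) * lam p) *\<^sub>R y p) p"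
      using has_pd_cong[OF D p _ has_pd_bilinear[OF bounded_bilinear_scaleR lam_pd[OF p] hx(2)[OF p]], of "pv z" True]
      by (simp add: zv)
    ultimately have eq: "lam p *\<^sub>R pv x p + (- (pv phi p / 4) * lam p) *\<^sub>R x p
        = lam p *\<^sub>R pu y p + (- (pu phi p / 4) * lam p) *\<^sub>R y p"
      using smooth_on_pd_commute[OF D smz p] by (auto dest!: has_pd_imp_pd)
    have "lam p * (- (pv phi p / 4)) = lam p * (- (lam p * g1 p))"
      using arg_cong[OF eq, of "\<lambda>w. w \<bullet> x p"] orth'[OF p] by (simp add: eqs p algebra_simps)
    then show "lam p * g1 p = pv phi p / 4"
      using lam_pos[of p] by simp
    have "lam p * (lam p * g2 p) = lam p * (pu phi p / 4)"
      using arg_cong[OF eq, of "\<lambda>w. w \<bullet> y p"] orth'[OF p] by (simp add: eqs p algebra_simps)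
    then show "lam p * g2 p = pu phi p / 4"
      using lam_pos[of p] by simp
  qed
  have xy: "pu x p = (pv phi p / 4) *\<^sub>R y p + (lam p * nu p) *\<^sub>R n1 p"
    "pu y p = (- (pv phi p / 4)) *\<^sub>R x p + (lam p * mu p) *\<^sub>R n2 p"
    "pv x p = (- (pu phi p / 4)) *\<^sub>R y p + (lam p * mu p) *\<^sub>R n2 p"
    "pv y p = (pu phi p / 4) *\<^sub>R x p + (- (lam p * nu p)) *\<^sub>R n1 p" if p: "p \<in> D" for p
    unfolding g[OF p, symmetric] by (simp_all add: eqs(1-4)[OF p] scaleR_add_right scaleR_diff_right)
  have hp: "has_pd b (\<lambda>q. pd c phi q / 4) (pd b (pd c phi) p / 4) p" if p: "p \<in> D" for b c p
    using has_pd_linear[OF bounded_linear_mult_right[of "1/4"] smooth_on_has_pd[OF smooth_on_pd[OF smooth_phi] p]] by simp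
  note hs = has_pd_bilinear[OF bounded_bilinear_scaleR]
  \<comment> \<open>The n1 component of the mixed derivative of x gives beta_1, that of y gives
    beta_2. Both are rewritten with \<open>nu_codazzi\<close>, and mu > 0 permits
    cancellation.\<close>
  have b: "lam p * b1 p = - pv theta p" "lam p * b2 p = pu theta p" if p: "p \<in> D" for p
  proof -
    have 1: "has_pd False (pu x)
       (((pv phi p / 4) *\<^sub>R pv y p + (pv (pv phi) p / 4) *\<^sub>R y p)
        + ((lam p * nu p) *\<^sub>R pv n1 p + (lam p * (pv nu p - pv phi p / 4 * nu p)) *\<^sub>R n1 p)) p"
      using has_pd_cong[OF D p _ has_pd_add[OF hs[OF hp[OF p, of False False] hx(2)[OF p]] hs[OF lam_nu_pd[OF p] hx(3)[OF p]]],
          of "pu x"] by (simp add: xy)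
    have 2: "has_pd True (pv x)
       (((- (pu phi p / 4)) *\<^sub>R pu y p + (- (pu (pu phi) p / 4)) *\<^sub>R y p)
        + ((lam p * mu p) *\<^sub>R pu n2 p + (lam p * (pu mu p - pu phi p / 4 * mu p)) *\<^sub>R n2 p)) p"
      using has_pd_cong[OF D p _ has_pd_add[OF hs[OF has_pd_minus[OF hp[OF p, of True True]] hx(2)[OF p]] hs[OF lam_mu_pd[OF p] hx(4)[OF p]]],
          of "pv x"] by (simp add: xy)
    have 3: "has_pd False (pu y)
       (((- (pv phi p / 4)) *\<^sub>R pv x p + (- (pv (pv phi) p / 4)) *\<^sub>R x p)
        + ((lam p * mu p) *\<^sub>R pv n2 p + (lam p * (pv mu p - pv phi p / 4 * mu p)) *\<^sub>R n2 p)) p"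
      using has_pd_cong[OF D p _ has_pd_add[OF hs[OF has_pd_minus[OF hp[OF p, of False False]] hx(1)[OF p]] hs[OF lam_mu_pd[OF p] hx(4)[OF p]]],
          of "pu y"] by (simp add: xy)
    have 4: "has_pd True (pv y)
       (((pu phi p / 4) *\<^sub>R pu x p + (pu (pu phi) p / 4) *\<^sub>R x p)
        + ((- (lam p * nu p)) *\<^sub>R pu n1 p + (- (lam p * (pu nu p - pu phi p / 4 * nu p))) *\<^sub>R n1 p)) p"
      using has_pd_cong[OF D p _ has_pd_add[OF hs[OF hp[OF p, of True True] hx(1)[OF p]] hs[OF has_pd_minus[OF lam_nu_pd[OF p]] hx(3)[OF p]]],
          of "pv y"] by (simp add: xy)
    note d = has_pd_imp_pd[OF 1, unfolded pd_simps] has_pd_imp_pd[OF 2, unfolded pd_simps]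
      has_pd_imp_pd[OF 3, unfolded pd_simps] has_pd_imp_pd[OF 4, unfolded pd_simps]
    have "pv (pu x) p \<bullet> n1 p = lam p * (pv nu p - pv phi p / 2 * nu p)"
      "pu (pv x) p \<bullet> n1 p = lam p * (mu p * - (lam p * b1 p))"
      "pv (pu y) p \<bullet> n1 p = lam p * (mu p * - (lam p * b2 p))"
      "pu (pv y) p \<bullet> n1 p = - (lam p * (pu nu p - pu phi p / 2 * nu p))"
      unfolding d eqs(5-8)[OF p] xy[OF p] by (simp_all add: inner_add_left inner_diff_left orth'[OF p])
        (simp_all add: algebra_simps)
    then have "lam p * (pv nu p - pv phi p / 2 * nu p) = lam p * (mu p * - (lam p * b1 p))"
      "lam p * (mu p * (lam p * b2 p)) = lam p * (pu nu p - pu phi p / 2 * nu p)"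
      using smooth_on_pd_commute[OF D smx(1) p] smooth_on_pd_commute[OF D smx(2) p] by simp_all
    then have "mu p * - (lam p * b1 p) = mu p * pv theta p" "mu p * (lam p * b2 p) = mu p * pu theta p"
      using lam_pos[of p] nu_codazzi[OF p, of False] nu_codazzi[OF p, of True] by (simp_all only: mult_cancel_left pd_simps) auto
    then have "mu p * (lam p * b1 p) = mu p * - pv theta p" "mu p * (lam p * b2 p) = mu p * pu theta p"
      by simp_all
    then show "lam p * b1 p = - pv theta p" "lam p * b2 p = pu theta p"
      using mu_pos[OF p] unfolding mult_cancel_left by auto
  qed
  have nn: "pu n1 p = (- (lam p * nu p)) *\<^sub>R x p - pv theta p *\<^sub>R n2 p"
    "pv n1 p = (lam p * nu p) *\<^sub>R y p + pu theta p *\<^sub>R n2 p"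
    "pu n2 p = (- (lam p * mu p)) *\<^sub>R y p + pv theta p *\<^sub>R n1 p"
    "pv n2 p = (- (lam p * mu p)) *\<^sub>R x p - pu theta p *\<^sub>R n1 p" if p: "p \<in> D" for p
    by (simp_all add: eqs(5-8)[OF p] b[OF p] scaleR_add_right scaleR_diff_right)
  define W :: "real \<times> real \<Rightarrow> real^4^4" where "W p = vector [x p, y p, n1 p, n2 p]" for p
  show thesis
  proof (rule that[of W])
    fix p assume p: "p \<in> D"
    show "has_pd b z (tang b (lam p) v* W p) p" for b
      using smooth_on_has_pd[OF smz p, of b] by (cases b) (simp_all add: tang_mult W_def zu zv p)
    show "has_pd b W (Cm b p ** W p) p" for b
    proof (rule has_pd_vec)
      fix i
      have "\<forall>i. has_pd b (\<lambda>q. W q $ i) ((Cm b p ** W p) $ i) p"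
        using hx[OF p, of b] by (cases b) (simp_all add: forall_4 Cm_def conn_rows, simp_all add: W_def xy nn p)
      then show "has_pd b (\<lambda>q. W q $ i) ((Cm b p ** W p) $ i) p"
        by blast
    qed
    show "W p ** transpose (W p) = mat 1"
      using orth'[OF p] by (simp add: vec_eq_iff[of "_ ** _"] matrix_mult_transpose_nth vec_eq_iff[of "_ $ _"] mat_def)
        (simp add: forall_4 W_def)
    show "0 < det (W p)"
      using por[OF p] by (simp add: pos_oriented_def W_def)
  qed
qed

text \<open>Both frames are orthogonal with positive determinant, so the constant matrix V^T W is a
  rotation, and the positions then differ by a constant vector.\<close>

lemma surface_unique:
  assumes conn: "connected D" and p0: "p0 \<in> D"
    and z1: "canonical_surface_with_invariants D z1 nu mu" and z2: "canonical_surface_with_invariants D z2 nu mu"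
  shows "proper_motion_related D z1 z2"
proof -
  obtain V where V: "\<And>b p. p \<in> D \<Longrightarrow> has_pd b z1 (tang b (lam p) v* V p) p"
    "\<And>b p. p \<in> D \<Longrightarrow> has_pd b V (Cm b p ** V p) p"
    "\<And>p. p \<in> D \<Longrightarrow> V p ** transpose (V p) = mat 1" "\<And>p. p \<in> D \<Longrightarrow> 0 < det (V p)"
    using surface_frame[OF z1] by blast
  obtain W where W: "\<And>b p. p \<in> D \<Longrightarrow> has_pd b z2 (tang b (lam p) v* W p) p"
    "\<And>b p. p \<in> D \<Longrightarrow> has_pd b W (Cm b p ** W p) p"
    "\<And>p. p \<in> D \<Longrightarrow> W p ** transpose (W p) = mat 1" "\<And>p. p \<in> D \<Longrightarrow> 0 < det (W p)"
    using surface_frame[OF z2] by blast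
  define M where "M = transpose (V p0) ** W p0"
  have M: "transpose (V p) ** W p = M" if "p \<in> D" for p
    unfolding M_def
    using zero_pd_imp_constant[OF D conn frames_gram_pd[OF V(2) W(2)] that p0] by simp
  have WV: "W p = V p ** M" if "p \<in> D" for p
    unfolding M[OF that, symmetric] by (simp add: matrix_mul_assoc V(3)[OF that])
  have orthM: "orthogonal_matrix M" and detM: "det M = 1"
  proof -
    have o: "orthogonal_matrix (V p0)" "orthogonal_matrix (W p0)"
      using V(3)[OF p0] W(3)[OF p0] by (simp_all add: orthogonal_matrix_def matrix_left_right_inverse)
    then show "orthogonal_matrix M"
      unfolding M_def by (intro orthogonal_matrix_mul) (simp_all add: orthogonal_matrix_transpose)
    have "det (V p0) = 1" "det (W p0) = 1"
      using det_orthogonal_matrix[OF o(1)] det_orthogonal_matrix[OF o(2)] V(4)[OF p0] W(4)[OF p0] by auto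
    then show "det M = 1"
      by (simp add: M_def det_mul)
  qed
  \<comment> \<open>Frames are stored as rows, so the rotation acts by \<open>v* M\<close>, that is,
    by \<open>transpose M\<close> on column vectors.\<close>
  define f where "f p = z2 p + - (z1 p v* M)" for p
  have "has_pd b f 0 p" if p: "p \<in> D" for b p
  proof -
    have "has_pd b f (tang b (lam p) v* W p + - ((tang b (lam p) v* V p) v* M)) p"
      unfolding f_def[abs_def]
      by (intro has_pd_add has_pd_minus W(1) p
          has_pd_linear[OF bounded_bilinear.bounded_linear_left[OF bounded_bilinear_vector_matrix_mult] V(1)[OF p]])
    then show ?thesis
      by (simp add: WV[OF p] vector_matrix_mul_assoc)
  qed
  then have "f p = f p0" if "p \<in> D" for p
    using zero_pd_imp_constant[OF D conn _ that p0] by blast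
  then have "z2 p = transpose M *v z1 p + f p0" if "p \<in> D" for p
    using that by (simp add: f_def algebra_simps)
  then show ?thesis
    unfolding proper_motion_related_def using orthM detM
    by (intro exI[of _ "transpose M"] exI[of _ "f p0"]) (simp add: orthogonal_matrix_transpose)
qed

end

theorem theorem6p4:
  fixes D :: "(real \<times> real) set"
    and nu mu :: "real \<times> real \<Rightarrow> real"
  assumes dom: "is_domain D"
    and sm_nu: "smooth_on D nu" and sm_mu: "smooth_on D mu"
    and mu_pos: "\<forall>p\<in>D. mu p > 0"
    and nu_nz: "\<forall>p\<in>D. nu p \<noteq> 0"
    and ne: "\<forall>p\<in>D. (mu p)^2 \<noteq> (nu p)^2"
    and grad: "\<forall>p\<in>D. pv (\<lambda>q. \<bar>(mu q)^2 - (nu q)^2\<bar>) p * pu (\<lambda>q. \<bar>(mu q)^2 - (nu q)^2\<bar>) p \<noteq> 0"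
    and eq1: "\<forall>p\<in>D. (1/4) * sqrt \<bar>(mu p)^2 - (nu p)^2\<bar>
                        * laplacian (\<lambda>q. ln \<bar>(mu q)^2 - (nu q)^2\<bar>) p
                      + (nu p)^2 + (mu p)^2 = 0"
    and eq2: "\<forall>p\<in>D. (1/2) * sqrt \<bar>(mu p)^2 - (nu p)^2\<bar>
                        * laplacian (\<lambda>q. ln \<bar>(mu q + nu q) / (mu q - nu q)\<bar>) p
                      + 2 * nu p * mu p = 0"
  shows "(\<exists>D0 z. is_domain D0 \<and> D0 \<subseteq> D \<and> canonical_surface_with_invariants D0 z nu mu)
       \<and> (\<forall>D1 z1 z2. is_domain D1 \<and> D1 \<subseteq> D
              \<and> canonical_surface_with_invariants D1 z1 nu mu
              \<and> canonical_surface_with_invariants D1 z2 nu mu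
              \<longrightarrow> proper_motion_related D1 z1 z2)"
proof
  interpret invariant_pair D nu mu
    using assms by unfold_locales (auto simp: is_domain_def)
  \<comment> \<open>On D the function |mu^2 - nu^2| is exp phi, so its partial derivatives vanish
    wherever those of \<open>phi\<close> do.\<close>
  have grad': "pd b phi p \<noteq> 0" if p: "p \<in> D" for b p
  proof
    assume *: "pd b phi p = 0"
    have "((\<lambda>x. exp x) has_real_derivative exp (phi p)) (at (phi p))"
      by (rule DERIV_exp)
    then have "has_pd b (\<lambda>q. exp (phi q)) (exp (phi p) * pd b phi p) p"
      by (rule has_pd_chain[OF phi_pd[OF p]])
    moreover have "exp (phi q) = \<bar>(mu q)\<^sup>2 - (nu q)\<^sup>2\<bar>" if "q \<in> D" for q
      using s_nz[OF that] by (simp add: phi_def)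
    ultimately have "has_pd b (\<lambda>q. \<bar>(mu q)\<^sup>2 - (nu q)\<^sup>2\<bar>) 0 p"
      using has_pd_cong[OF D p, of "\<lambda>q. exp (phi q)"] * by simp
    from has_pd_imp_pd[OF this] show False
      using grad p by (cases b) auto
  qed
  \<comment> \<open>Multiplying \<open>eq1\<close> by 4 lam^2 removes the square root, by
    \<open>lam_sq\<close>.\<close>
  have gauss: "laplacian phi p = - 4 * (lam p)\<^sup>2 * ((nu p)\<^sup>2 + (mu p)\<^sup>2)" if p: "p \<in> D" for p
    using bspec[OF eq1 p, folded phi_def] lam_sq[OF p] unfolding phi_def[symmetric, abs_def] by algebra
  have ricci: "laplacian theta p = - 2 * (lam p)\<^sup>2 * nu p * mu p" if p: "p \<in> D" for p
  proof -
    define f where "f q = ln \<bar>(mu q + nu q) / (mu q - nu q)\<bar>" for q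
    have f: "f = (\<lambda>q. 2 * theta q)"
      by (simp add: f_def theta_def fun_eq_iff)
    have fb: "pd b f q = 2 * pd b theta q" if "q \<in> D" for b q
      unfolding f by (intro has_pd_imp_pd has_pd_linear[OF bounded_linear_mult_right] theta_pd that)
    have "pd b (pd b f) p = 2 * pd b (pd b theta) p" for b
    proof (rule has_pd_imp_pd)
      have "has_pd b (\<lambda>q. 2 * pd b theta q) (2 * pd b (pd b theta) p) p"
        by (intro has_pd_linear[OF bounded_linear_mult_right] smooth_on_has_pd[OF smooth_on_pd[OF smooth_theta] p])
      then show "has_pd b (pd b f) (2 * pd b (pd b theta) p) p"
        using has_pd_cong[OF D p, of "\<lambda>q. 2 * pd b theta q" "pd b f"] fb by simp
    qed
    from this[of True] this[of False] have "laplacian f p = 2 * laplacian theta p"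
      by (simp add: laplacian_def)
    then show ?thesis
      using bspec[OF eq2 p, folded f_def] lam_sq[OF p] by algebra
  qed
  show "\<exists>D0 z. is_domain D0 \<and> D0 \<subseteq> D \<and> canonical_surface_with_invariants D0 z nu mu"
    using dom exists_surface[OF _ grad' gauss ricci] unfolding is_domain_def by blast
  show "\<forall>D1 z1 z2. is_domain D1 \<and> D1 \<subseteq> D \<and> canonical_surface_with_invariants D1 z1 nu mu
      \<and> canonical_surface_with_invariants D1 z2 nu mu \<longrightarrow> proper_motion_related D1 z1 z2"
  proof (intro allI impI)
    fix D1 z1 z2
    assume *: "is_domain D1 \<and> D1 \<subseteq> D \<and> canonical_surface_with_invariants D1 z1 nu mu
      \<and> canonical_surface_with_invariants D1 z2 nu mu"
    then interpret D1: invariant_pair D1 nu mu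
      by (intro sub) (auto simp: is_domain_def)
    show "proper_motion_related D1 z1 z2"
      using * D1.surface_unique unfolding is_domain_def by blast
  qed
qed

end
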